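(* Let $x_1\in(0,1)$, let $V:\mathbb{R}\to\mathbb{R}$ be continuous, $E\in\mathbb{R}$ and $a:=E-V$, such that $V(x)<V(0)$ for $x\in(0,1]$, $a(x)=k_1x^2+k_2x$ for all $x\le x_1$ with $k_1<0$ and $k_2>-k_1x_1>0$, and $V(x)=V(1)$ for $x>1$. Assume moreover that $a$ is $\mathcal{C}^2$ on $[x_1,1]$. For $\varepsilon>0$ put $$\nu=-\frac{k_2^2}{8\varepsilon\sqrt{-k_1^3}},\qquad z(x)=\frac{k_2+2k_1x}{\sqrt{2\varepsilon}\,(-k_1^3)^{1/4}},$$ and let $\psi_\varepsilon$ be the solution of the boundary value problem $$\begin{cases}\varepsilon^2\psi''(x)+a(x)\psi(x)=0,\quad x\in(x_1,1),\\ \varepsilon^{1/2}\,U(\nu,z(x_1))\,\psi'(x_1)+\sqrt2(-k_1)^{1/4}\,U'(\nu,z(x_1))\,\psi(x_1)=0,\\ \varepsilon\psi'(1)-i\sqrt{a(1)}\,\psi(1)=-2i\sqrt{a(1)},\end{cases}$$ extended to $[0,x_1]$ by the parabolic cylinder function solution, i.e. by $\psi_\varepsilon(x)=c\,U(\nu,z(x))$ on $[0,x_1]$ with the constant $c=c(\varepsilon)\in\mathbb{C}$ for which $\psi_\varepsilon$ and $\psi_\varepsilon'$ are continuous at $x_1$. Then: a) $\|\psi_\varepsilon\|_{L^\infty(0,1)}$ is of the (sharp) order $\Theta(\varepsilon^{-1/6})$ as $\varepsilon\to0$. b) $\varepsilon\|\psi_\varepsilon'\|_{L^\infty(0,1)}$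 is uniformly bounded as $\varepsilon\to0$.
   Context: $U(\nu,z)$ is the parabolic cylinder function: the standard solution of $w''(z)-(\frac{z^2}{4}+\nu)w(z)=0$ that decays as $z\to+\infty$, normalized by $U(\nu,z)\sim e^{-z^2/4}z^{-\nu-1/2}$; $U'$ denotes its derivative with respect to $z$. $f(\varepsilon)=\Theta(g(\varepsilon))$ as $\varepsilon\to0$ means: there are $c_1,c_2,\delta>0$ with $c_1|g(\varepsilon)|\le|f(\varepsilon)|\le c_2|g(\varepsilon)|$ for all $0<\varepsilon<\delta$. Derivatives of $a$ at $x_1$ and $1$ are one-sided (from within $[x_1,1]$). *)

theory Defs
  imports
    "HOL-Analysis.Analysis"
    "HOL-Library.Landau_Symbols"
    "HOL-Probability.Essential_Supremum"
begin

definition is_parabolic_cylinder_U :: "real \<Rightarrow> (real \<Rightarrow> real) \<Rightarrow> bool" where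
  "is_parabolic_cylinder_U \<nu> w \<longleftrightarrow>
     (\<exists>w'. \<forall>z. (w has_real_derivative w' z) (at z) \<and>
                (w' has_real_derivative (z^2 / 4 + \<nu>) * w z) (at z)) \<and>
     w \<sim>[at_top] (\<lambda>z. exp (- (z^2) / 4) * z powr (- \<nu> - 1 / 2))"

text \<open>
  The normalisation at \<open>+\<infinity>\<close> determines the solution: two solutions with this asymptotics differ
  by a solution that is negligible against the recessive one, hence by \<open>0\<close>. Only real
  parameter and argument are needed.
\<close>
definition parabolic_cylinder_U :: "real \<Rightarrow> real \<Rightarrow> real" where
  "parabolic_cylinder_U \<nu> = (THE w. is_parabolic_cylinder_U \<nu> w)"

definition nu_param :: "real \<Rightarrow> real \<Rightarrow> real \<Rightarrow> real" where
  "nu_param k1 k2 \<epsilon> = - (k2^2 / (8 * \<epsilon> * sqrt (- (k1^3))))"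

definition z_map :: "real \<Rightarrow> real \<Rightarrow> real \<Rightarrow> real \<Rightarrow> real" where
  "z_map k1 k2 \<epsilon> x = (k2 + 2 * k1 * x) / (sqrt (2 * \<epsilon>) * (- (k1^3)) powr (1 / 4))"

text \<open>\<open>C\<^sup>2\<close> with derivatives taken within \<open>S\<close>, i.e. one-sided at the ends of an interval.\<close>
definition C2_on :: "(real \<Rightarrow> real) \<Rightarrow> real set \<Rightarrow> bool" where
  "C2_on f S \<longleftrightarrow>
     (\<exists>f' f''. (\<forall>x\<in>S. (f has_real_derivative f' x) (at x within S) \<and>
                       (f' has_real_derivative f'' x) (at x within S)) \<and>
               continuous_on S f'')"

text \<open>
  Classical solutions on \<open>[x1, 1]\<close>; the derivatives in the boundary conditions are one-sided, so
  values of \<open>\<psi>\<close> outside \<open>[x1, 1]\<close> are irrelevant.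
\<close>
definition solves_bvp ::
    "(real \<Rightarrow> real) \<Rightarrow> real \<Rightarrow> real \<Rightarrow> real \<Rightarrow> real \<Rightarrow> (real \<Rightarrow> complex) \<Rightarrow> bool" where
  "solves_bvp a k1 k2 x1 \<epsilon> \<psi> \<longleftrightarrow>
     (\<exists>\<psi>'. (\<forall>x\<in>{x1..1}. (\<psi> has_vector_derivative \<psi>' x) (at x within {x1..1})) \<and>
        continuous_on {x1..1} \<psi>' \<and>
        (\<forall>x\<in>{x1<..<1}. \<exists>\<psi>2. (\<psi>' has_vector_derivative \<psi>2) (at x) \<and>
           of_real (\<epsilon>^2) * \<psi>2 + of_real (a x) * \<psi> x = 0) \<and>
        of_real (sqrt \<epsilon> * parabolic_cylinder_U (nu_param k1 k2 \<epsilon>) (z_map k1 k2 \<epsilon> x1)) * \<psi>' x1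
          + of_real (sqrt 2 * (- k1) powr (1 / 4)
              * deriv (parabolic_cylinder_U (nu_param k1 k2 \<epsilon>)) (z_map k1 k2 \<epsilon> x1)) * \<psi> x1 = 0 \<and>
        of_real \<epsilon> * \<psi>' 1 - \<i> * of_real (sqrt (a 1)) * \<psi> 1 = - 2 * \<i> * of_real (sqrt (a 1)))"

definition extended_by_U ::
    "real \<Rightarrow> real \<Rightarrow> real \<Rightarrow> real \<Rightarrow> (real \<Rightarrow> complex) \<Rightarrow> bool" where
  "extended_by_U k1 k2 x1 \<epsilon> \<psi> \<longleftrightarrow>
     (\<exists>c. \<forall>x\<in>{0..x1}.
        \<psi> x = c * of_real (parabolic_cylinder_U (nu_param k1 k2 \<epsilon>) (z_map k1 k2 \<epsilon> x))) \<and>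
     isCont \<psi> x1 \<and> \<psi> differentiable (at x1) \<and>
     isCont (\<lambda>x. vector_derivative \<psi> (at x)) x1"

text \<open>Extended-real valued, so that an infinite norm is not mistaken for a finite one.\<close>
definition Linf_norm :: "real set \<Rightarrow> (real \<Rightarrow> complex) \<Rightarrow> ereal" where
  "Linf_norm S f = esssup (lebesgue_on S) (\<lambda>x. ereal (norm (f x)))"

definition Theta_at_0 :: "(real \<Rightarrow> ereal) \<Rightarrow> (real \<Rightarrow> real) \<Rightarrow> bool" where
  "Theta_at_0 f g \<longleftrightarrow>
     (\<exists>c1>0. \<exists>c2>0. \<exists>\<delta>>0. \<forall>\<epsilon>. 0 < \<epsilon> \<and> \<epsilon> < \<delta> \<longrightarrow>
        ereal (c1 * \<bar>g \<epsilon>\<bar>) \<le> \<bar>f \<epsilon>\<bar> \<and> \<bar>f \<epsilon>\<bar> \<le> ereal (c2 * \<bar>g \<epsilon>\<bar>))"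

end

theory Submission
  imports Defs "HOL-Real_Asymp.Real_Asymp"
begin

text \<open>
  The proof rests on energies of $\varepsilon^2 \psi'' + a \psi = 0$ rather than on asymptotic expansions of
  special functions. On $[0, x_1]$ the wave function is a complex constant times a real solution of the same
  equation, once it is known that $U$ exists and solves Weber's equation. Existence for the large
  negative parameters \<open>\<nu>\<close> comes from Weber's integral together with a ladder operator that lowers \<open>\<nu>\<close> by one
  (\<open>recessive_weber_exists\<close>); uniqueness comes from the Wronskian (\<open>is_parabolic_cylinder_U_unique\<close>).

  A constant multiple of a real function carries no current $\mathrm{Im}(\overline{\psi}\,\psi')$, and
  the current is conserved. The boundary condition at $1$ then fixes the classical energy
  $\varepsilon^2 |\psi'|^2 + a |\psi|^2$ at $1$ to be $4 a(1)$ (\<open>glued_solution\<close>). Its derivative is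
  $a' |\psi|^2$. Hence it stays of order one wherever $a$ is bounded away from $0$
  (\<open>energy_comparable_with_end\<close>), and it is increasing near the turning point $0$, where $a' > 0$. This
  bounds $\varepsilon |\psi'|$ on all of $(0,1)$, and $|\psi|$ away from the turning point.

  Near $0$, where $a$ is comparable to $x$, the classical energy misses the amplitude: it only gives
  $|\psi| \le C a^{-1/2}$, while the true amplitude is $a^{-1/4}$. The energy of the Liouville transform
  does see it, and it is of order one down to the distance $\varepsilon^{2/3}$
  (\<open>wkb_energy_comparable\<close>). There $a^{-1/4}$ is of the order $\varepsilon^{-1/6}$. Within the layer
  $0 \le x \le \varepsilon^{2/3}$ the monotone classical energy rules out further growth
  (\<open>turning_point_upper\<close>); at its edge the WKB energy and the equation rule out a smaller size
  (\<open>turning_point_lower\<close>). This is the sharp order.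
\<close>

section \<open>A two-sided Gronwall inequality\<close>

text \<open>
  If $f$ changes at relative rate at most $k = K'$, then $f e^{-K}$ decreases and $f e^{K}$ increases.
  The second conclusion runs the estimate backwards, so values at the two ends control each other; every
  energy comparison below and the uniqueness of $U$ are instances.
\<close>
lemma gronwall_two_sided:
  fixes f f' K k :: "real \<Rightarrow> real"
  assumes "s \<le> t"
    and cont: "continuous_on {s..t} f" "continuous_on {s..t} K"
    and f: "\<And>x. s < x \<Longrightarrow> x < t \<Longrightarrow> (f has_real_derivative f' x) (at x)"
    and K: "\<And>x. s < x \<Longrightarrow> x < t \<Longrightarrow> (K has_real_derivative k x) (at x)"
    and le: "\<And>x. s < x \<Longrightarrow> x < t \<Longrightarrow> \<bar>f' x\<bar> \<le> k x * f x"
  shows "f t \<le> exp (K t - K s) * f s" and "f s \<le> exp (K t - K s) * f t"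
proof -
  have "- (f s * exp (- K s)) \<le> - (f t * exp (- K t))"
  proof (rule DERIV_nonneg_imp_increasing_open[OF \<open>s \<le> t\<close>])
    fix x assume x: "s < x" "x < t"
    have "((\<lambda>x. - (f x * exp (- K x))) has_real_derivative (k x * f x - f' x) * exp (- K x)) (at x)"
      by (auto intro!: derivative_eq_intros f[OF x] K[OF x] simp: algebra_simps)
    moreover have "(k x * f x - f' x) * exp (- K x) \<ge> 0"
      using le[OF x] by (intro mult_nonneg_nonneg) auto
    ultimately show "\<exists>y. ((\<lambda>x. - (f x * exp (- K x))) has_real_derivative y) (at x) \<and> 0 \<le> y"
      by blast
  qed (intro continuous_intros cont)
  thus "f t \<le> exp (K t - K s) * f s"
    by (simp add: exp_diff exp_minus field_simps)
  have "f s * exp (K s) \<le> f t * exp (K t)"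
  proof (rule DERIV_nonneg_imp_increasing_open[OF \<open>s \<le> t\<close>])
    fix x assume x: "s < x" "x < t"
    have "((\<lambda>x. f x * exp (K x)) has_real_derivative (k x * f x + f' x) * exp (K x)) (at x)"
      by (auto intro!: derivative_eq_intros f[OF x] K[OF x] simp: algebra_simps)
    moreover have "(k x * f x + f' x) * exp (K x) \<ge> 0"
      using le[OF x] by (intro mult_nonneg_nonneg) auto
    ultimately show "\<exists>y. ((\<lambda>x. f x * exp (K x)) has_real_derivative y) (at x) \<and> 0 \<le> y"
      by blast
  qed (intro continuous_intros cont)
  thus "f s \<le> exp (K t - K s) * f t"
    by (simp add: exp_diff field_simps)
qed

section \<open>Weber's integral\<close>

lemma Gamma_set_integral:
  fixes r z :: real
  assumes "r > -1" "z > 0"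
  shows "set_integrable lborel {0<..} (\<lambda>t. t powr r * exp (- z * t))"
    and "(LBINT t:{0<..}. t powr r * exp (- z * t)) = Gamma (r + 1) * z powr (- r - 1)"
proof -
  define g where "g = (\<lambda>t::real. indicator {0<..} t *\<^sub>R (t powr r * exp (- t)))"
  have g0: "\<And>t. 0 \<le> g t" by (simp add: g_def)
  have [measurable]: "g \<in> borel_measurable borel" unfolding g_def by measurable
  have "((\<lambda>t. t powr (r + 1 - 1) / exp t) has_integral Gamma (r + 1)) {0..}"
    using assms by (intro Gamma_integral_real) auto
  hence "((\<lambda>t. if t \<in> {0..} then t powr (r + 1 - 1) / exp t else 0) has_integral Gamma (r + 1)) UNIV"
    unfolding has_integral_restrict_UNIV .
  also have "(\<lambda>t. if t \<in> {0..} then t powr (r + 1 - 1) / exp t else 0) = g"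
    by (auto simp: g_def fun_eq_iff exp_minus field_simps indicator_def)
  finally have I: "(g has_integral Gamma (r + 1)) UNIV" .
  have G: "Gamma (r + 1) \<ge> 0" using assms by (intro less_imp_le Gamma_real_pos) auto
  have "has_bochner_integral lborel g (Gamma (r + 1))"
  proof (rule has_bochner_integral_nn_integral)
    show "(\<integral>\<^sup>+ x. ennreal (g x) \<partial>lborel) = ennreal (Gamma (r + 1))"
      using g0 I by (intro nn_integral_has_integral_lborel) auto
  qed (use G g0 in auto)
  hence hb: "integrable lborel g" "integral\<^sup>L lborel g = Gamma (r + 1)"
    by (auto simp: has_bochner_integral_iff)
  have eq: "indicator {0<..} t *\<^sub>R (t powr r * exp (- z * t)) = z powr (-r) * g (0 + z * t)" for t
    using \<open>z > 0\<close> by (auto simp: g_def indicator_def zero_less_mult_iff powr_mult powr_minus)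
  have "integrable lborel (\<lambda>t. g (0 + z * t))"
    using hb \<open>z > 0\<close> by (intro lborel_integrable_real_affine) auto
  thus "set_integrable lborel {0<..} (\<lambda>t. t powr r * exp (- z * t))"
    unfolding set_integrable_def eq by (rule integrable_mult_right)
  have "Gamma (r + 1) = z * integral\<^sup>L lborel (\<lambda>t. g (0 + z * t))"
    using lborel_integral_real_affine[of z g 0] \<open>z > 0\<close> hb by simp
  thus "(LBINT t:{0<..}. t powr r * exp (- z * t)) = Gamma (r + 1) * z powr (- r - 1)"
    unfolding set_lebesgue_integral_def eq using \<open>z > 0\<close>
    by (simp add: powr_diff)
qed

text \<open>
  In classical notation this is $\Gamma(r+1)\, e^{z^2/4}\, U(r + \frac12, z)$. Without the factor
  $e^{z^2/4}$ differentiation in $z$ is just the shift from $r$ to $r+1$ with a change of sign.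
\<close>
definition weber_integral :: "real \<Rightarrow> real \<Rightarrow> real" where
  "weber_integral r z = (LBINT t:{0<..}. t powr r * exp (- (t\<^sup>2) / 2 - z * t))"

text \<open>
  Completing the square, $-t^2/2 - zt \le (z-1)^2/2 - t$, so that a Gamma integral is a majorant for
  every real $z$.
\<close>
lemma weber_integrable:
  fixes r z :: real
  assumes "r > -1"
  shows "set_integrable lborel {0<..} (\<lambda>t. t powr r * exp (- (t\<^sup>2) / 2 - z * t))"
proof -
  have "set_integrable lborel {0<..} (\<lambda>t. exp ((z - 1)\<^sup>2 / 2) * (t powr r * exp (- 1 * t)))"
    using Gamma_set_integral(1)[of r 1] assms by (intro set_integrable_mult_right) auto
  thus ?thesis
  proof (rule set_integrable_bound)
    show "set_borel_measurable lborel {0<..} (\<lambda>t. t powr r * exp (- (t\<^sup>2) / 2 - z * t))"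
      unfolding set_borel_measurable_def by measurable
    show "AE t in lborel. t \<in> {0<..} \<longrightarrow> norm (t powr r * exp (- (t\<^sup>2) / 2 - z * t))
             \<le> norm (exp ((z - 1)\<^sup>2 / 2) * (t powr r * exp (- 1 * t)))"
    proof (intro AE_I2 impI)
      fix t :: real
      have "- (t\<^sup>2) / 2 - z * t \<le> (z - 1)\<^sup>2 / 2 + (- 1 * t)"
        using zero_le_power2[of "t + z - 1"] by (simp add: power2_eq_square algebra_simps)
      hence "exp (- (t\<^sup>2) / 2 - z * t) \<le> exp ((z - 1)\<^sup>2 / 2) * exp (- 1 * t)"
        by (simp flip: exp_add)
      thus "norm (t powr r * exp (- (t\<^sup>2) / 2 - z * t))
             \<le> norm (exp ((z - 1)\<^sup>2 / 2) * (t powr r * exp (- 1 * t)))"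
        by (simp add: abs_mult mult_left_mono mult.left_commute)
    qed
  qed
qed

lemma exp_remainder2: "\<bar>exp x - 1 - x\<bar> \<le> x\<^sup>2 / 2 * exp \<bar>x\<bar>" for x :: real
proof -
  obtain t where t: "\<bar>t\<bar> \<le> \<bar>x\<bar>" "exp x = (\<Sum>m<2. x ^ m / fact m) + exp t / fact 2 * x ^ 2"
    using Maclaurin_exp_le[of x 2] by blast
  have eq: "exp x - 1 - x = exp t / 2 * x\<^sup>2"
    using t(2) by (simp add: numeral_2_eq_2)
  moreover have "exp t * x\<^sup>2 \<le> exp \<bar>x\<bar> * x\<^sup>2" using t(1) by (intro mult_right_mono) auto
  ultimately show ?thesis
    unfolding eq by (simp add: abs_mult mult.commute)
qed

text \<open>
  Differentiation under the integral sign can be done by hand: the remainder of the exponential of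
  order two integrates to at most $\delta^2$ times the same kind of integral with exponent $r+2$,
  taken at $z-1$ to absorb the factor $e^{|\delta| t} \le e^t$.
\<close>
lemma weber_integral_deriv:
  assumes "r > -1"
  shows "(weber_integral r has_real_derivative - weber_integral (r + 1) z) (at z)"
proof -
  define f where "f = (\<lambda>r z t::real. t powr r * exp (- (t\<^sup>2) / 2 - z * t))"
  have int: "set_integrable lborel {0<..} (f q y)" if "q > -1" for q y
    using weber_integrable[OF that] by (simp add: f_def)
  have W: "weber_integral q y = (LBINT t:{0<..}. f q y t)" for q y
    by (simp add: weber_integral_def f_def)
  define C where "C = weber_integral (r + 2) (z - 1) / 2"
  have main: "\<bar>weber_integral r (z + d) - weber_integral r z + d * weber_integral (r + 1) z\<bar> \<le> d\<^sup>2 * C"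
    if d: "\<bar>d\<bar> \<le> 1" for d
  proof -
    have i1: "set_integrable lborel {0<..} (\<lambda>t. f r (z + d) t - f r z t + d * f (r + 1) z t)"
      using assms by (intro set_integral_add set_integral_diff set_integrable_mult_right int) auto
    have eq: "weber_integral r (z + d) - weber_integral r z + d * weber_integral (r + 1) z =
          (LBINT t:{0<..}. f r (z + d) t - f r z t + d * f (r + 1) z t)"
      unfolding W using assms by (simp add: set_integral_add set_integral_diff int)
    have "\<bar>LBINT t:{0<..}. f r (z + d) t - f r z t + d * f (r + 1) z t\<bar>
        \<le> (LBINT t:{0<..}. \<bar>f r (z + d) t - f r z t + d * f (r + 1) z t\<bar>)"
      using set_integral_norm_bound[OF i1] by simp
    also have "\<dots> \<le> (LBINT t:{0<..}. d\<^sup>2 / 2 * f (r + 2) (z - 1) t)"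
    proof (rule set_integral_mono)
      show "set_integrable lborel {0<..} (\<lambda>t. \<bar>f r (z + d) t - f r z t + d * f (r + 1) z t\<bar>)"
        using set_integrable_abs[OF i1] .
      show "set_integrable lborel {0<..} (\<lambda>t. d\<^sup>2 / 2 * f (r + 2) (z - 1) t)"
        using assms by (intro set_integrable_mult_right int) auto
      fix t :: real assume "t \<in> {0<..}"
      hence t: "t > 0" by simp
      have e: "f r (z + d) t - f r z t + d * f (r + 1) z t = f r z t * (exp (- d * t) - 1 - (- d * t))"
        using t by (simp add: f_def powr_add algebra_simps flip: exp_add)
      from exp_remainder2[of "- d * t"] have "\<bar>exp (- d * t) - 1 - (- d * t)\<bar> \<le> (- d * t)\<^sup>2 / 2 * exp \<bar>- d * t\<bar>"
        .
      also have "\<dots> \<le> d\<^sup>2 / 2 * (t\<^sup>2 * exp t)"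
      proof -
        have "exp \<bar>- d * t\<bar> \<le> exp t"
          using d t by (simp add: abs_mult mult_left_le_one_le)
        hence "d\<^sup>2 * t\<^sup>2 * exp \<bar>- d * t\<bar> \<le> d\<^sup>2 * t\<^sup>2 * exp t"
          by (intro mult_left_mono) auto
        thus ?thesis by (simp add: power_mult_distrib)
      qed
      finally have "\<bar>f r (z + d) t - f r z t + d * f (r + 1) z t\<bar> \<le> f r z t * (d\<^sup>2 / 2 * (t\<^sup>2 * exp t))"
        unfolding e abs_mult by (intro mult_mono) (auto simp: f_def)
      also have "\<dots> = d\<^sup>2 / 2 * f (r + 2) (z - 1) t"
        using t by (simp add: f_def powr_add algebra_simps flip: exp_add)
      finally show "\<bar>f r (z + d) t - f r z t + d * f (r + 1) z t\<bar> \<le> d\<^sup>2 / 2 * f (r + 2) (z - 1) t" .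
    qed
    also have "\<dots> = d\<^sup>2 * C" unfolding C_def W by simp
    finally show ?thesis unfolding eq .
  qed
  have "((\<lambda>d. (weber_integral r (z + d) - weber_integral r z) / d + weber_integral (r + 1) z) \<longlongrightarrow> 0) (at 0)"
  proof (rule Lim_null_comparison)
    show "\<forall>\<^sub>F d in at 0. norm ((weber_integral r (z + d) - weber_integral r z) / d + weber_integral (r + 1) z)
            \<le> \<bar>d\<bar> * C"
      unfolding eventually_at
    proof (intro exI[of _ 1] conjI ballI impI)
      fix d :: real assume d: "d \<noteq> 0 \<and> dist d 0 < 1"
      have "(weber_integral r (z + d) - weber_integral r z) / d + weber_integral (r + 1) z
          = (weber_integral r (z + d) - weber_integral r z + d * weber_integral (r + 1) z) / d"
        using d by (simp add: field_simps)
      also have "norm \<dots> \<le> (d\<^sup>2 * C) / \<bar>d\<bar>"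
        using d main[of d] by (simp add: divide_right_mono)
      also have "\<dots> = \<bar>d\<bar> * C" 
      proof -
        have "d\<^sup>2 = \<bar>d\<bar>\<^sup>2" by simp
        thus ?thesis using d by (simp add: power2_eq_square[of "\<bar>d\<bar>"] del: power2_abs abs_mult_self_eq)
      qed
      finally show "norm ((weber_integral r (z + d) - weber_integral r z) / d + weber_integral (r + 1) z)
            \<le> \<bar>d\<bar> * C" .
    qed auto
    show "((\<lambda>d. \<bar>d\<bar> * C) \<longlongrightarrow> 0) (at 0)" by (rule tendsto_eq_intros refl | simp)+
  qed
  hence "((\<lambda>d. (weber_integral r (z + d) - weber_integral r z) / d - (- weber_integral (r + 1) z)) \<longlongrightarrow> 0) (at 0)"
    by simp
  thus ?thesis unfolding DERIV_def by (rule LIM_zero_cancel)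
qed

text \<open>
  The integrand of the left side minus the right side is the derivative of
  $- t^{r+1} e^{-t^2/2 - zt}$, which vanishes at both ends. For $h(z)$ = \<open>weber_integral r z\<close> the
  identity reads $h'' - z h' = (r+1) h$, which is what makes $e^{-z^2/4} h$ solve Weber's equation.
\<close>
lemma weber_integral_recurrence:
  assumes "r > 0"
  shows "weber_integral (r + 2) z + z * weber_integral (r + 1) z = (r + 1) * weber_integral r z"
proof -
  define f where "f = (\<lambda>r t::real. t powr r * exp (- (t\<^sup>2) / 2 - z * t))"
  have int: "set_integrable lborel {0<..} (f q)" if "q > -1" for q
    using weber_integrable[OF that] by (simp add: f_def)
  have W: "weber_integral q z = (LBINT t:{0<..}. f q t)" for q
    by (simp add: weber_integral_def f_def)
  define g where "g = (\<lambda>t. (r + 1) * f r t - z * f (r + 1) t - f (r + 2) t)"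
  have i: "set_integrable lborel {0<..} g"
    unfolding g_def using assms by (intro set_integral_diff set_integrable_mult_right int) auto
  have D: "(f (r + 1) has_real_derivative g t) (at t)" if "t > 0" for t
  proof -
    have "((\<lambda>t. t powr (r + 1)) has_real_derivative (r + 1) * t powr r) (at t)"
      using has_real_derivative_powr[of t "r + 1"] that by simp
    moreover have "((\<lambda>t. exp (- (t\<^sup>2) / 2 - z * t)) has_real_derivative
        exp (- (t\<^sup>2) / 2 - z * t) * (- t - z)) (at t)"
      by (auto intro!: derivative_eq_intros)
    ultimately have "(f (r + 1) has_real_derivative (r + 1) * t powr r * exp (- (t\<^sup>2) / 2 - z * t)
        + exp (- (t\<^sup>2) / 2 - z * t) * (- t - z) * t powr (r + 1)) (at t)"
      unfolding f_def by (rule DERIV_mult)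
    thus ?thesis using that by (simp add: f_def g_def powr_add algebra_simps power2_eq_square)
  qed
  have E: "einterval 0 \<infinity> = {0<..}" by (auto simp: einterval_def)
  have "(LBINT t=0..\<infinity>. g t) = 0 - 0"
  proof (rule interval_integral_FTC_integrable)
    show "(f (r + 1) has_vector_derivative g x) (at x)" if "0 < ereal x" for x
      using D[of x] that by (simp add: has_real_derivative_iff_has_vector_derivative)
    show "isCont g x" if "0 < ereal x" for x
      using that unfolding g_def f_def by (intro continuous_intros) auto
    show "set_integrable lborel (einterval 0 \<infinity>) g" using i E by simp
    have "((\<lambda>t. t powr (r + 1) * exp (- (t\<^sup>2) / 2 - z * t)) \<longlongrightarrow> 0) (at_right 0)"
      using assms by real_asymp
    thus "((f (r + 1) \<circ> real_of_ereal) \<longlongrightarrow> 0) (at_right 0)"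
      unfolding zero_ereal_def by (simp add: ereal_tendsto_simps f_def)
    have "((\<lambda>t. t powr (r + 1) * exp (- (t\<^sup>2) / 2 - z * t)) \<longlongrightarrow> 0) at_top"
      using assms by real_asymp
    thus "((f (r + 1) \<circ> real_of_ereal) \<longlongrightarrow> 0) (at_left \<infinity>)"
      by (simp add: ereal_tendsto_simps f_def)
  qed auto
  hence "(LBINT t:{0<..}. g t) = 0"
    by (simp add: interval_lebesgue_integral_def E)
  also have "(LBINT t:{0<..}. g t) =
      (r + 1) * weber_integral r z - z * weber_integral (r + 1) z - weber_integral (r + 2) z"
    unfolding W g_def using assms by (simp add: set_integral_diff int)
  finally show ?thesis by simp
qed

text \<open>
  The bounds $1 - t^2/2 \le e^{-t^2/2} \le 1$ reduce the integral to Gamma integrals, up to a relative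
  error of order $z^{-2}$.
\<close>
lemma weber_integral_bounds:
  assumes "r > -1" "z > 0"
  shows "weber_integral r z \<le> Gamma (r + 1) * z powr (- r - 1)"
    and "weber_integral r z \<ge> Gamma (r + 1) * z powr (- r - 1) - Gamma (r + 3) * z powr (- r - 3) / 2"
proof -
  note G = Gamma_set_integral[OF assms]
  have G2: "set_integrable lborel {0<..} (\<lambda>t. t powr (r + 2) * exp (- z * t))"
    "(LBINT t:{0<..}. t powr (r + 2) * exp (- z * t)) = Gamma (r + 3) * z powr (- r - 3)"
    using Gamma_set_integral[of "r + 2" z] assms by (simp_all add: add.commute)
  have "weber_integral r z \<le> (LBINT t:{0<..}. t powr r * exp (- z * t))"
    unfolding weber_integral_def
    by (intro set_integral_mono weber_integrable G assms mult_left_mono) auto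
  thus "weber_integral r z \<le> Gamma (r + 1) * z powr (- r - 1)" using G by simp
  have "(LBINT t:{0<..}. t powr r * exp (- z * t) - (1 / 2) * (t powr (r + 2) * exp (- z * t))) \<le> weber_integral r z"
    unfolding weber_integral_def
  proof (intro set_integral_mono weber_integrable G assms set_integral_diff set_integrable_mult_right G2)
    fix t :: real assume "t \<in> {0<..}"
    hence t: "t > 0" by simp
    have "1 - t\<^sup>2 / 2 \<le> exp (- (t\<^sup>2) / 2)"
      using exp_ge_add_one_self[of "- (t\<^sup>2) / 2"] by simp
    hence "t powr r * exp (- z * t) * (1 - t\<^sup>2 / 2) \<le> t powr r * exp (- z * t) * exp (- (t\<^sup>2) / 2)"
      by (intro mult_left_mono) auto
    also have "\<dots> = t powr r * exp (- (t\<^sup>2) / 2 - z * t)"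
      by (simp add: mult.assoc add.commute flip: exp_add)
    finally show "t powr r * exp (- z * t) - 1 / 2 * (t powr (r + 2) * exp (- z * t))
            \<le> t powr r * exp (- (t\<^sup>2) / 2 - z * t)"
      using t by (simp add: powr_add algebra_simps)
  qed
  also have "(LBINT t:{0<..}. t powr r * exp (- z * t) - (1 / 2) * (t powr (r + 2) * exp (- z * t)))
     = Gamma (r + 1) * z powr (- r - 1) - Gamma (r + 3) * z powr (- r - 3) / 2"
    using G G2 by (subst set_integral_diff) (auto intro!: set_integrable_mult_right)
  finally show "weber_integral r z \<ge> Gamma (r + 1) * z powr (- r - 1) - Gamma (r + 3) * z powr (- r - 3) / 2" .
qed

lemma weber_integral_tendsto:
  assumes "r > -1"
  shows "((\<lambda>z. weber_integral r z * z powr (r + 1)) \<longlongrightarrow> Gamma (r + 1)) at_top"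
proof (rule tendsto_sandwich)
  show "\<forall>\<^sub>F z in at_top. Gamma (r + 1) - Gamma (r + 3) / 2 * z powr (- 2) \<le> weber_integral r z * z powr (r + 1)"
    using eventually_gt_at_top[of 0]
  proof eventually_elim
    case (elim z)
    have "Gamma (r + 1) - Gamma (r + 3) / 2 * z powr (- 2)
        = Gamma (r + 1) * (z powr (- r - 1) * z powr (r + 1))
          - Gamma (r + 3) / 2 * (z powr (- r - 3) * z powr (r + 1))"
      using elim by (simp flip: powr_add)
    also have "\<dots> = (Gamma (r + 1) * z powr (- r - 1) - Gamma (r + 3) * z powr (- r - 3) / 2) * z powr (r + 1)"
      by (simp add: algebra_simps)
    also have "\<dots> \<le> weber_integral r z * z powr (r + 1)"
      by (intro mult_right_mono weber_integral_bounds assms elim) auto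
    finally show ?case .
  qed
  show "\<forall>\<^sub>F z in at_top. weber_integral r z * z powr (r + 1) \<le> Gamma (r + 1)"
    using eventually_gt_at_top[of 0]
  proof eventually_elim
    case (elim z)
    have "weber_integral r z * z powr (r + 1) \<le> Gamma (r + 1) * z powr (- r - 1) * z powr (r + 1)"
      by (intro mult_right_mono weber_integral_bounds assms elim) auto
    moreover have "z powr (- r - 1) * z powr (r + 1) = 1"
      using elim by (simp flip: powr_add)
    ultimately show ?case by (simp add: algebra_simps)
  qed
  show "((\<lambda>z. Gamma (r + 1) - Gamma (r + 3) / 2 * z powr (- 2)) \<longlongrightarrow> Gamma (r + 1)) at_top"
    by real_asymp
qed auto

section \<open>The parabolic cylinder function solves Weber's equation\<close>

definition weber_solution :: "real \<Rightarrow> (real \<Rightarrow> real) \<Rightarrow> (real \<Rightarrow> real) \<Rightarrow> bool" where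
  "weber_solution \<nu> w w' \<longleftrightarrow>
     (\<forall>z. (w has_real_derivative w' z) (at z) \<and>
          (w' has_real_derivative (z\<^sup>2 / 4 + \<nu>) * w z) (at z))"

definition U_asymp :: "real \<Rightarrow> real \<Rightarrow> real" where
  "U_asymp \<nu> z = exp (- (z\<^sup>2) / 4) * z powr (- \<nu> - 1 / 2)"

text \<open>
  Besides the normalisation of $U$ the logarithmic derivative $w'/w \sim -z/2$ is recorded: it is what
  lets the asymptotics survive the ladder operator that lowers \<open>\<nu>\<close>.
\<close>
definition recessive_weber :: "real \<Rightarrow> (real \<Rightarrow> real) \<Rightarrow> (real \<Rightarrow> real) \<Rightarrow> bool" where
  "recessive_weber \<nu> w w' \<longleftrightarrow> weber_solution \<nu> w w' \<and>
     ((\<lambda>z. w z / U_asymp \<nu> z) \<longlongrightarrow> 1) at_top \<and>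
     ((\<lambda>z. w' z / (z * w z)) \<longlongrightarrow> - 1 / 2) at_top"

lemma U_asymp_pos: "z > 0 \<Longrightarrow> U_asymp \<nu> z > 0"
  by (simp add: U_asymp_def)

lemma recessive_weber_nonzero:
  assumes "recessive_weber \<nu> w w'"
  shows "\<forall>\<^sub>F z in at_top. w z \<noteq> 0"
proof -
  have "\<forall>\<^sub>F z in at_top. w z / U_asymp \<nu> z > 0"
    using assms unfolding recessive_weber_def by (auto intro: order_tendstoD(1))
  thus ?thesis by eventually_elim auto
qed

text \<open>
  Weber's integral with $r = \nu - \frac12$, divided by $\Gamma(r+1)$ and multiplied by $e^{-z^2/4}$. The
  recurrence between consecutive integrals is the differential equation, and their asymptotics give
  both limits.
\<close>
lemma recessive_weber_base:
  assumes "\<nu> > 1 / 2"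
  shows "\<exists>w w'. recessive_weber \<nu> w w'"
proof -
  define r where "r = \<nu> - 1 / 2"
  have r: "r > 0" using assms by (simp add: r_def)
  define J where "J = weber_integral"
  have dJ: "(J q has_real_derivative - J (q + 1) z) (at z)" if "q > -1" for q z
    using weber_integral_deriv[OF that] by (simp add: J_def)
  define g where "g = Gamma (r + 1)"
  have g: "g > 0" unfolding g_def using r by (intro Gamma_real_pos) auto
  define w where "w = (\<lambda>z. exp (- (z\<^sup>2) / 4) * J r z / g)"
  define w' where "w' = (\<lambda>z. exp (- (z\<^sup>2) / 4) * (- J (r + 1) z - z / 2 * J r z) / g)"
  have de: "((\<lambda>z. exp (- (z\<^sup>2) / 4)) has_real_derivative - (z / 2) * exp (- (z\<^sup>2) / 4)) (at z)" for z :: real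
    by (auto intro!: derivative_eq_intros)
  have "(w has_real_derivative w' z) (at z)" for z
  proof -
    have "(w has_real_derivative
        (- (z / 2) * exp (- (z\<^sup>2) / 4) * J r z + - J (r + 1) z * exp (- (z\<^sup>2) / 4)) / g) (at z)"
      unfolding w_def using r by (intro DERIV_cdivide DERIV_mult de dJ) auto
    thus ?thesis by (simp add: w'_def algebra_simps)
  qed
  moreover have "(w' has_real_derivative (z\<^sup>2 / 4 + \<nu>) * w z) (at z)" for z
  proof -
    have "((\<lambda>z. - J (r + 1) z - z / 2 * J r z) has_real_derivative
        J (r + 2) z - J r z / 2 + z / 2 * J (r + 1) z) (at z)"
      using r dJ[of "r + 1" z] dJ[of r z] by (auto intro!: derivative_eq_intros simp: add.assoc field_simps)
    hence "(w' has_real_derivative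
       ((- (z / 2) * exp (- (z\<^sup>2) / 4)) * (- J (r + 1) z - z / 2 * J r z) +
        (J (r + 2) z - J r z / 2 + z / 2 * J (r + 1) z) * exp (- (z\<^sup>2) / 4)) / g) (at z)"
      unfolding w'_def by (intro DERIV_cdivide DERIV_mult de)
    also have "J (r + 2) z = (r + 1) * J r z - z * J (r + 1) z"
      using weber_integral_recurrence[OF r, of z] by (simp add: J_def)
    also have "((- (z / 2) * exp (- (z\<^sup>2) / 4)) * (- J (r + 1) z - z / 2 * J r z) +
        ((r + 1) * J r z - z * J (r + 1) z - J r z / 2 + z / 2 * J (r + 1) z) * exp (- (z\<^sup>2) / 4)) / g
        = (z\<^sup>2 / 4 + \<nu>) * w z"
      by (simp add: w_def r_def algebra_simps power2_eq_square add_divide_distrib diff_divide_distrib)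
    finally show ?thesis .
  qed
  ultimately have "weber_solution \<nu> w w'" by (simp add: weber_solution_def)
  moreover have lim: "((\<lambda>z. J q z * z powr (q + 1)) \<longlongrightarrow> Gamma (q + 1)) at_top" if "q > -1" for q
    using weber_integral_tendsto[OF that] by (simp add: J_def)
  have "((\<lambda>z. w z / U_asymp \<nu> z) \<longlongrightarrow> 1) at_top"
  proof (rule Lim_transform_eventually)
    show "((\<lambda>z. J r z * z powr (r + 1) / g) \<longlongrightarrow> 1) at_top"
      using tendsto_divide[OF lim[of r] tendsto_const[of g]] r g by (simp flip: g_def)
    show "\<forall>\<^sub>F z in at_top. J r z * z powr (r + 1) / g = w z / U_asymp \<nu> z"
      using eventually_gt_at_top[of 0]
    proof eventually_elim
      case (elim z)
      have "z powr (r + 1) * z powr (- \<nu> - 1 / 2) = 1"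
        using elim by (simp add: r_def flip: powr_add)
      hence "z powr (r + 1) = 1 / z powr (- \<nu> - 1 / 2)"
        using elim by (simp add: eq_divide_eq)
      thus ?case using elim by (simp add: w_def U_asymp_def)
    qed
  qed
  moreover have "((\<lambda>z. w' z / (z * w z)) \<longlongrightarrow> - 1 / 2) at_top"
  proof (rule Lim_transform_eventually)
    have "((\<lambda>z. (J (r + 1) z * z powr (r + 2)) / (J r z * z powr (r + 1))) \<longlongrightarrow> Gamma (r + 2) / g) at_top"
    proof -
      have "((\<lambda>z. (J (r + 1) z * z powr (r + 1 + 1)) / (J r z * z powr (r + 1))) \<longlongrightarrow> Gamma (r + 1 + 1) / g) at_top"
        unfolding g_def using r g by (intro tendsto_divide lim) (simp_all flip: g_def)
      thus ?thesis by (simp only: add.assoc one_add_one)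
    qed
    moreover have "((\<lambda>z::real. 1 / z\<^sup>2) \<longlongrightarrow> 0) at_top" by real_asymp
    ultimately have "((\<lambda>z. - ((J (r + 1) z * z powr (r + 2)) / (J r z * z powr (r + 1)) * (1 / z\<^sup>2)) - 1 / 2)
       \<longlongrightarrow> - (Gamma (r + 2) / g * 0) - 1 / 2) at_top"
      by (intro tendsto_diff tendsto_minus tendsto_mult tendsto_const)
    thus "((\<lambda>z. - ((J (r + 1) z * z powr (r + 2)) / (J r z * z powr (r + 1)) * (1 / z\<^sup>2)) - 1 / 2)
       \<longlongrightarrow> - 1 / 2) at_top" by simp
    have "\<forall>\<^sub>F z in at_top. J r z * z powr (r + 1) > 0"
      by (rule order_tendstoD(1)[OF lim[of r]]) (use r g in \<open>simp_all flip: g_def\<close>)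
    thus "\<forall>\<^sub>F z in at_top. - ((J (r + 1) z * z powr (r + 2)) / (J r z * z powr (r + 1)) * (1 / z\<^sup>2)) - 1 / 2
         = w' z / (z * w z)"
      using eventually_gt_at_top[of 0]
    proof eventually_elim
      case (elim z)
      hence J: "J r z \<noteq> 0" by auto
      have p: "z powr (r + 2) = z powr (r + 1) * z"
        using elim by (simp add: powr_add power2_eq_square)
      have "- ((J (r + 1) z * z powr (r + 2)) / (J r z * z powr (r + 1)) * (1 / z\<^sup>2)) - 1 / 2
          = (- J (r + 1) z - z / 2 * J r z) / (z * J r z)"
        using elim J unfolding p by (simp add: field_simps power2_eq_square)
      also have "\<dots> = w' z / (z * w z)"
        using g J elim by (simp add: w_def w'_def)
      finally show ?case .
    qed
  qed
  ultimately show ?thesis unfolding recessive_weber_def by blast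
qed

text \<open>
  The ladder operator $v = \frac z2 w - w'$ maps solutions for \<open>\<nu>\<close> to solutions for \<open>\<nu> - 1\<close>. Since
  $w' \sim -\frac z2 w$, it multiplies the recessive solution by $z$ to leading order, which is exactly
  the ratio of the two normalisations.
\<close>
lemma recessive_weber_lower:
  assumes "recessive_weber \<nu> w w'"
  shows "\<exists>v v'. recessive_weber (\<nu> - 1) v v'"
proof -
  have dw: "(w has_real_derivative w' z) (at z)" and dw': "(w' has_real_derivative (z\<^sup>2 / 4 + \<nu>) * w z) (at z)" for z
    using assms by (auto simp: recessive_weber_def weber_solution_def)
  have lim: "((\<lambda>z. w z / U_asymp \<nu> z) \<longlongrightarrow> 1) at_top" "((\<lambda>z. w' z / (z * w z)) \<longlongrightarrow> - 1 / 2) at_top"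
    using assms by (auto simp: recessive_weber_def)
  define v where "v = (\<lambda>z. z / 2 * w z - w' z)"
  define v' where "v' = (\<lambda>z. (1 / 2 - \<nu>) * w z - z / 2 * v z)"
  have dv: "(v has_real_derivative v' z) (at z)" for z
    unfolding v_def v'_def
    by (auto intro!: derivative_eq_intros dw dw' simp: algebra_simps power2_eq_square)
  moreover have "(v' has_real_derivative (z\<^sup>2 / 4 + (\<nu> - 1)) * v z) (at z)" for z
  proof -
    have "((\<lambda>z. (1 / 2 - \<nu>) * w z - z / 2 * v z) has_real_derivative
        (1 / 2 - \<nu>) * w' z - (1 / 2 * v z + z / 2 * v' z)) (at z)"
      by (auto intro!: derivative_eq_intros dw dv simp: field_simps)
    hence "(v' has_real_derivative (1 / 2 - \<nu>) * w' z - (1 / 2 * v z + z / 2 * v' z)) (at z)"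
      by (simp only: v'_def)
    also have "(1 / 2 - \<nu>) * w' z - (1 / 2 * v z + z / 2 * v' z) = (z\<^sup>2 / 4 + (\<nu> - 1)) * v z"
      by (simp add: v'_def v_def field_simps power2_eq_square)
    finally show ?thesis .
  qed
  ultimately have "weber_solution (\<nu> - 1) v v'" by (simp add: weber_solution_def)
  moreover have nz: "\<forall>\<^sub>F z in at_top. w z \<noteq> 0 \<and> z > 0"
    using recessive_weber_nonzero[OF assms] eventually_gt_at_top[of 0] by eventually_elim auto
  have vw: "((\<lambda>z. v z / (z * w z)) \<longlongrightarrow> 1) at_top"
  proof (rule Lim_transform_eventually)
    show "((\<lambda>z. 1 / 2 - w' z / (z * w z)) \<longlongrightarrow> 1) at_top"
      using tendsto_diff[OF tendsto_const[of "1 / 2"] lim(2)] by simp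
    show "\<forall>\<^sub>F z in at_top. 1 / 2 - w' z / (z * w z) = v z / (z * w z)"
      using nz by eventually_elim (simp add: v_def field_simps)
  qed
  moreover have "((\<lambda>z. v z / U_asymp (\<nu> - 1) z) \<longlongrightarrow> 1) at_top"
  proof (rule Lim_transform_eventually)
    show "((\<lambda>z. v z / (z * w z) * (w z / U_asymp \<nu> z)) \<longlongrightarrow> 1) at_top"
      using tendsto_mult[OF vw lim(1)] by simp
    show "\<forall>\<^sub>F z in at_top. v z / (z * w z) * (w z / U_asymp \<nu> z) = v z / U_asymp (\<nu> - 1) z"
      using nz
    proof eventually_elim
      case (elim z)
      have "U_asymp (\<nu> - 1) z = z powr (1 + (- \<nu> - 1 / 2)) * exp (- (z\<^sup>2) / 4)"
        by (simp add: U_asymp_def)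
      also have "\<dots> = z * U_asymp \<nu> z"
        using elim by (simp only: powr_add U_asymp_def) simp
      finally show ?case using elim U_asymp_pos[of z \<nu>] by (simp add: field_simps)
    qed
  qed
  moreover have "((\<lambda>z. v' z / (z * v z)) \<longlongrightarrow> - 1 / 2) at_top"
  proof (rule Lim_transform_eventually)
    have "((\<lambda>z::real. 1 / z\<^sup>2) \<longlongrightarrow> 0) at_top" by real_asymp
    hence "((\<lambda>z. (1 / 2 - \<nu>) * (1 / z\<^sup>2) / (v z / (z * w z)) - 1 / 2) \<longlongrightarrow> (1 / 2 - \<nu>) * 0 / 1 - 1 / 2) at_top"
      using vw by (intro tendsto_intros) auto
    thus "((\<lambda>z. (1 / 2 - \<nu>) * (1 / z\<^sup>2) / (v z / (z * w z)) - 1 / 2) \<longlongrightarrow> - 1 / 2) at_top" by simp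
    have "\<forall>\<^sub>F z in at_top. v z / (z * w z) > 0"
      using vw by (auto intro: order_tendstoD(1))
    thus "\<forall>\<^sub>F z in at_top. (1 / 2 - \<nu>) * (1 / z\<^sup>2) / (v z / (z * w z)) - 1 / 2 = v' z / (z * v z)"
      using nz
    proof eventually_elim
      case (elim z)
      hence "v z \<noteq> 0" by auto
      thus ?case using elim by (simp add: v'_def field_simps power2_eq_square)
    qed
  qed
  ultimately show ?thesis unfolding recessive_weber_def by blast
qed

text \<open>
  For \<open>\<nu> \<le> - 1/2\<close>, in particular for the large negative parameters of the turning point problem, Weber's
  integral diverges at $t = 0$; they are reached from a large parameter by finitely many steps down the
  ladder.
\<close>
lemma recessive_weber_exists: "\<exists>w w'. recessive_weber \<nu> w w'"
proof -
  obtain n :: nat where n: "real n > 1 / 2 - \<nu>" using reals_Archimedean2 by blast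
  have "\<exists>w w'. recessive_weber (\<nu> + real n - real m) w w'" for m
  proof (induction m)
    case 0
    thus ?case using recessive_weber_base[of "\<nu> + real n"] n by simp
  next
    case (Suc m)
    then obtain w w' where "recessive_weber (\<nu> + real n - real m) w w'" by blast
    from recessive_weber_lower[OF this] show ?case by (simp add: algebra_simps)
  qed
  from this[of n] show ?thesis by simp
qed

lemma weber_solution_diff:
  assumes "weber_solution \<nu> u u'" "weber_solution \<nu> w w'"
  shows "weber_solution \<nu> (\<lambda>z. u z - w z) (\<lambda>z. u' z - w' z)"
  using assms unfolding weber_solution_def right_diff_distrib by (blast intro: DERIV_diff)

text \<open>
  Gronwall's inequality for $d^2 + d'^2$, whose relative rate of change is at most $|1 + z^2/4 + \nu|$.
\<close>
lemma weber_solution_zero: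
  assumes "weber_solution \<nu> d d'" "d t = 0" "d' t = 0" "s \<le> t"
  shows "d s = 0"
proof -
  define f where "f = (\<lambda>x. (d x)\<^sup>2 + (d' x)\<^sup>2)"
  have D: "(d has_real_derivative d' x) (at x)" "(d' has_real_derivative (x\<^sup>2 / 4 + \<nu>) * d x) (at x)" for x
    using assms(1) by (auto simp: weber_solution_def)
  have Df: "(f has_real_derivative 2 * d x * d' x * (1 + x\<^sup>2 / 4 + \<nu>)) (at x)" for x
    unfolding f_def by (auto intro!: derivative_eq_intros D simp: algebra_simps)
  define K where "K = (\<lambda>x::real. (1 + \<bar>\<nu>\<bar>) * x + x ^ 3 / 12)"
  have DK: "(K has_real_derivative 1 + x\<^sup>2 / 4 + \<bar>\<nu>\<bar>) (at x)" for x
    unfolding K_def by (auto intro!: derivative_eq_intros simp: field_simps power2_eq_square)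
  have "f s \<le> exp (K t - K s) * f t"
  proof (rule gronwall_two_sided(2)[OF \<open>s \<le> t\<close> _ _ Df DK])
    show "continuous_on {s..t} f" using Df
      by (meson DERIV_isCont continuous_at_imp_continuous_on)
    show "continuous_on {s..t} K" unfolding K_def by (intro continuous_intros) auto
    fix x
    have "0 \<le> (\<bar>d x\<bar> - \<bar>d' x\<bar>)\<^sup>2" by simp
    hence "2 * \<bar>d x\<bar> * \<bar>d' x\<bar> \<le> f x" by (simp add: f_def power2_diff)
    moreover have "\<bar>1 + x\<^sup>2 / 4 + \<nu>\<bar> \<le> 1 + x\<^sup>2 / 4 + \<bar>\<nu>\<bar>"
      using zero_le_power2[of x] by linarith
    ultimately have "2 * \<bar>d x\<bar> * \<bar>d' x\<bar> * \<bar>1 + x\<^sup>2 / 4 + \<nu>\<bar> \<le> f x * (1 + x\<^sup>2 / 4 + \<bar>\<nu>\<bar>)"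
      by (intro mult_mono) (auto simp: f_def)
    thus "\<bar>2 * d x * d' x * (1 + x\<^sup>2 / 4 + \<nu>)\<bar> \<le> (1 + x\<^sup>2 / 4 + \<bar>\<nu>\<bar>) * f x"
      by (simp add: abs_mult mult.commute)
  qed
  also have "f t = 0" using assms by (simp add: f_def)
  finally have "(d s)\<^sup>2 + (d' s)\<^sup>2 \<le> 0" by (simp add: f_def)
  thus ?thesis by (simp add: sum_power2_le_zero_iff)
qed

lemma asymp_equiv_iff_quotient_tendsto:
  "w \<sim>[at_top] (\<lambda>z. exp (- (z^2) / 4) * z powr (- \<nu> - 1 / 2))
     \<longleftrightarrow> ((\<lambda>z. w z / U_asymp \<nu> z) \<longlongrightarrow> 1) at_top"
proof -
  have "\<forall>\<^sub>F z in at_top. (if w z = 0 \<and> U_asymp \<nu> z = 0 then 1 else w z / U_asymp \<nu> z) = w z / U_asymp \<nu> z"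
    using eventually_gt_at_top[of 0]
    by eventually_elim (simp add: U_asymp_def)
  thus ?thesis
    unfolding asymp_equiv_def U_asymp_def[symmetric] by (rule tendsto_cong)
qed

lemma is_parabolic_cylinder_U_iff:
  "is_parabolic_cylinder_U \<nu> w \<longleftrightarrow>
     (\<exists>w'. weber_solution \<nu> w w') \<and> ((\<lambda>z. w z / U_asymp \<nu> z) \<longlongrightarrow> 1) at_top"
  unfolding is_parabolic_cylinder_U_def asymp_equiv_iff_quotient_tendsto weber_solution_def by blast

text \<open>
  Let $d$ be the difference of two candidates and $w$ one of them. Their Wronskian is a constant $k$ and
  $(d/w)' = k/w^2$. As $w \to 0$, this derivative is at least $|k|$ in modulus far out, yet $d/w \to 0$;
  so $k = 0$, hence $d/w$ is constant and therefore zero far out, and $d$ vanishes everywhere.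
\<close>
lemma is_parabolic_cylinder_U_unique:
  assumes "is_parabolic_cylinder_U \<nu> u" "is_parabolic_cylinder_U \<nu> w"
  shows "u = w"
proof -
  obtain u' w' where u: "weber_solution \<nu> u u'" and w: "weber_solution \<nu> w w'"
    and lim: "((\<lambda>z. u z / U_asymp \<nu> z) \<longlongrightarrow> 1) at_top" "((\<lambda>z. w z / U_asymp \<nu> z) \<longlongrightarrow> 1) at_top"
    using assms unfolding is_parabolic_cylinder_U_iff by blast
  define d where "d = (\<lambda>z. u z - w z)"
  define d' where "d' = (\<lambda>z. u' z - w' z)"
  have d: "weber_solution \<nu> d d'" unfolding d_def d'_def by (rule weber_solution_diff[OF u w])
  have Dd: "(d has_real_derivative d' x) (at x)" "(d' has_real_derivative (x\<^sup>2 / 4 + \<nu>) * d x) (at x)" for x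
    using d by (auto simp: weber_solution_def)
  have Dw: "(w has_real_derivative w' x) (at x)" "(w' has_real_derivative (x\<^sup>2 / 4 + \<nu>) * w x) (at x)" for x
    using w by (auto simp: weber_solution_def)
  define k where "k = w 0 * d' 0 - w' 0 * d 0"
  have k: "w x * d' x - w' x * d x = k" for x
  proof -
    have "((\<lambda>x. w x * d' x - w' x * d x) has_real_derivative 0) (at x)" for x
      by (auto intro!: derivative_eq_intros Dd Dw simp: algebra_simps)
    from DERIV_isconst_all[OF allI[OF this]] show ?thesis unfolding k_def by blast
  qed
  define q where "q = (\<lambda>z. d z / w z)"
  have "(U_asymp \<nu> \<longlongrightarrow> 0) at_top"
    unfolding U_asymp_def[abs_def] by real_asymp
  with tendsto_mult[OF lim(2) this] have "((\<lambda>z. w z / U_asymp \<nu> z * U_asymp \<nu> z) \<longlongrightarrow> 0) at_top"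
    by simp
  from order_tendstoD(2)[OF this, of 1]
  have "\<forall>\<^sub>F z in at_top. w z / U_asymp \<nu> z * U_asymp \<nu> z < 1"
    by simp
  moreover have "\<forall>\<^sub>F z in at_top. w z / U_asymp \<nu> z > 0"
    using lim(2) by (auto intro: order_tendstoD(1))
  ultimately have "\<forall>\<^sub>F z in at_top. 0 < w z \<and> w z < 1"
    using eventually_gt_at_top[of 0]
  proof eventually_elim
    case (elim z)
    have "U_asymp \<nu> z > 0" using U_asymp_pos elim by auto
    thus ?case using elim by (simp add: zero_less_divide_iff)
  qed
  then obtain Z where Z: "\<And>z. z \<ge> Z \<Longrightarrow> 0 < w z \<and> w z < 1"
    by (auto simp: eventually_at_top_linorder)
  have Dq: "(q has_real_derivative k / (w x)\<^sup>2) (at x)" if "x \<ge> Z" for x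
    unfolding q_def using Z[OF that]
    by (auto intro!: derivative_eq_intros Dd Dw simp: k[of x, symmetric] power2_eq_square algebra_simps)
  have q0: "(q \<longlongrightarrow> 0) at_top"
  proof (rule Lim_transform_eventually)
    show "((\<lambda>z. (u z / U_asymp \<nu> z) / (w z / U_asymp \<nu> z) - 1) \<longlongrightarrow> 0) at_top"
      using tendsto_diff[OF tendsto_divide[OF lim] tendsto_const[of 1]] by simp
    show "\<forall>\<^sub>F z in at_top. (u z / U_asymp \<nu> z) / (w z / U_asymp \<nu> z) - 1 = q z"
      using eventually_ge_at_top[of Z] eventually_gt_at_top[of 0]
    proof eventually_elim
      case (elim z)
      thus ?case using Z[of z] U_asymp_pos[of z \<nu>] by (simp add: q_def d_def field_simps)
    qed
  qed
  have q1: "((\<lambda>z. q (z + 1)) \<longlongrightarrow> 0) at_top"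
    by (rule filterlim_compose[OF q0]) real_asymp
  have "((\<lambda>z. \<bar>q (z + 1) - q z\<bar>) \<longlongrightarrow> 0) at_top"
    using tendsto_rabs[OF tendsto_diff[OF q1 q0]] by simp
  moreover have "\<forall>\<^sub>F z in at_top. \<bar>k\<bar> \<le> \<bar>q (z + 1) - q z\<bar>"
    using eventually_ge_at_top[of Z]
  proof eventually_elim
    case (elim z)
    \<comment> \<open>An increment over a unit interval already shows the size of $k$.\<close>
    obtain y where y: "y > z" "q (z + 1) - q z = (z + 1 - z) * (k / (w y)\<^sup>2)"
      using MVT2[of z "z + 1" q "\<lambda>x. k / (w x)\<^sup>2"] Dq elim by force
    have "0 < w y" "w y < 1" using Z[of y] y(1) elim by auto
    hence "(w y)\<^sup>2 \<le> 1" "0 < (w y)\<^sup>2" by (auto simp: power_le_one)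
    hence "\<bar>k\<bar> * (w y)\<^sup>2 \<le> \<bar>k\<bar> * 1" by (intro mult_left_mono) auto
    hence "\<bar>k\<bar> \<le> \<bar>k\<bar> / (w y)\<^sup>2" using \<open>0 < (w y)\<^sup>2\<close> by (simp add: pos_le_divide_eq)
    thus ?case using y(2) by (simp add: abs_divide)
  qed
  ultimately have "\<bar>k\<bar> \<le> 0" by (intro tendsto_lowerbound) auto
  hence k0: "k = 0" by simp
  have qZ: "q z = 0" if "z \<ge> Z" for z
  proof -
    have "q y = q z" if "y \<ge> z" for y
    proof (cases "y = z")
      case False
      hence "z < y" using that by simp
      obtain c where "c > z" "q y - q z = (y - z) * (k / (w c)\<^sup>2)"
        using MVT2[of z y q "\<lambda>x. k / (w x)\<^sup>2"] Dq \<open>z \<ge> Z\<close> \<open>z < y\<close> by force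
      thus ?thesis using k0 by simp
    qed auto
    hence "(q \<longlongrightarrow> q z) at_top"
      by (intro tendsto_eventually eventually_mono[OF eventually_ge_at_top[of z]])
    from tendsto_unique[OF _ this q0] show ?thesis by simp
  qed
  have dZ: "d z = 0" if "z \<ge> Z" for z
    using Z[OF that] qZ[OF that] by (auto simp: q_def)
  have "d' (Z + 1) = 0"
  proof -
    have "w (Z + 1) * d' (Z + 1) = 0" using k[of "Z + 1"] k0 dZ[of "Z + 1"] by simp
    thus ?thesis using Z[of "Z + 1"] by auto
  qed
  hence "d s = 0" for s
    using weber_solution_zero[OF d, of "Z + 1" s] dZ by (cases "s \<le> Z + 1") auto
  thus ?thesis by (auto simp: d_def fun_eq_iff)
qed

text \<open>
  The definite description is resolved by existence and uniqueness; from here on only the differential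
  equation and the fact that $U$ is real-valued enter.
\<close>
lemma parabolic_cylinder_U_solution:
  "\<exists>U'. weber_solution \<nu> (parabolic_cylinder_U \<nu>) U'"
proof -
  obtain w w' where "recessive_weber \<nu> w w'" using recessive_weber_exists by blast
  hence "is_parabolic_cylinder_U \<nu> w"
    unfolding is_parabolic_cylinder_U_iff recessive_weber_def by blast
  hence "is_parabolic_cylinder_U \<nu> (parabolic_cylinder_U \<nu>)"
    unfolding parabolic_cylinder_U_def by (rule theI[of "is_parabolic_cylinder_U \<nu>"]) (rule is_parabolic_cylinder_U_unique[OF _ \<open>is_parabolic_cylinder_U \<nu> w\<close>])
  thus ?thesis unfolding is_parabolic_cylinder_U_iff by blast
qed

section \<open>The classical energy\<close>

text \<open>
  Solutions of $e^2 W'' + a W = 0$ with values in a real inner product space, so that the estimates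
  apply to complex wave functions without splitting them into real and imaginary parts. The equation is
  asked for in the open interval only, so that pieces on both sides of the interface can be used
  separately.
\<close>
definition semiclassical_solution ::
    "real \<Rightarrow> (real \<Rightarrow> real) \<Rightarrow> real \<Rightarrow> real \<Rightarrow> (real \<Rightarrow> 'a::real_inner) \<Rightarrow> (real \<Rightarrow> 'a) \<Rightarrow> bool" where
  "semiclassical_solution e a s t W W' \<longleftrightarrow>
     continuous_on {s..t} W \<and> continuous_on {s..t} W' \<and>
     (\<forall>x\<in>{s<..<t}. (W has_vector_derivative W' x) (at x) \<and>
                   (W' has_vector_derivative (- (a x / e\<^sup>2)) *\<^sub>R W x) (at x))"

lemma semiclassical_solution_subset:
  assumes "semiclassical_solution e a s t W W'" "s \<le> s'" "t' \<le> t"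
  shows "semiclassical_solution e a s' t' W W'"
proof -
  have "{s'..t'} \<subseteq> {s..t}" "{s'<..<t'} \<subseteq> {s<..<t}" using assms by auto
  thus ?thesis using assms(1) unfolding semiclassical_solution_def
    by (meson continuous_on_subset subsetD)
qed

definition energy ::
    "real \<Rightarrow> (real \<Rightarrow> real) \<Rightarrow> (real \<Rightarrow> 'a::real_inner) \<Rightarrow> (real \<Rightarrow> 'a) \<Rightarrow> real \<Rightarrow> real" where
  "energy e a W W' x = e\<^sup>2 * (norm (W' x))\<^sup>2 + a x * (norm (W x))\<^sup>2"

lemma has_real_derivative_inner:
  fixes f g :: "real \<Rightarrow> 'a::real_inner"
  assumes "(f has_vector_derivative f') (at x)" "(g has_vector_derivative g') (at x)"
  shows "((\<lambda>x. f x \<bullet> g x) has_real_derivative (f x \<bullet> g' + f' \<bullet> g x)) (at x)"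
  unfolding has_real_derivative_iff_has_vector_derivative
  by (rule bounded_bilinear.has_vector_derivative[OF bounded_bilinear_inner assms])

text \<open>
  The terms with $W \bullet W'$ cancel by the equation, so the energy changes only through $a$.
\<close>
lemma energy_deriv:
  assumes W: "(W has_vector_derivative W' x) (at x)"
    and W': "(W' has_vector_derivative (- (a x / e\<^sup>2)) *\<^sub>R W x) (at x)"
    and a: "(a has_real_derivative a') (at x)" and "e \<noteq> 0"
  shows "(energy e a W W' has_real_derivative a' * (norm (W x))\<^sup>2) (at x)"
proof -
  have "((\<lambda>x. e\<^sup>2 * (W' x \<bullet> W' x) + a x * (W x \<bullet> W x)) has_real_derivative
      e\<^sup>2 * (W' x \<bullet> (- (a x / e\<^sup>2)) *\<^sub>R W x + (- (a x / e\<^sup>2)) *\<^sub>R W x \<bullet> W' x) +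
      (a' * (W x \<bullet> W x) + (W x \<bullet> W' x + W' x \<bullet> W x) * a x)) (at x)"
    by (intro DERIV_add DERIV_cmult DERIV_mult a has_real_derivative_inner W W')
  also have "e\<^sup>2 * (W' x \<bullet> (- (a x / e\<^sup>2)) *\<^sub>R W x + (- (a x / e\<^sup>2)) *\<^sub>R W x \<bullet> W' x) +
      (a' * (W x \<bullet> W x) + (W x \<bullet> W' x + W' x \<bullet> W x) * a x) = a' * (norm (W x))\<^sup>2"
    using \<open>e \<noteq> 0\<close> by (simp add: power2_norm_eq_inner inner_commute field_simps)
  finally show ?thesis
    unfolding energy_def[abs_def] power2_norm_eq_inner .
qed

lemma continuous_on_energy:
  assumes "semiclassical_solution e a s t W W'" "continuous_on {s..t} a"
  shows "continuous_on {s..t} (energy e a W W')"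
  using assms unfolding semiclassical_solution_def energy_def[abs_def]
  by (auto intro!: continuous_intros)

lemma energy_mono:
  assumes sol: "semiclassical_solution e a s t W W'" and "s \<le> t" "e \<noteq> 0"
    and cont: "continuous_on {s..t} a"
    and a: "\<And>x. s < x \<Longrightarrow> x < t \<Longrightarrow> (a has_real_derivative a' x) (at x)"
    and pos: "\<And>x. s < x \<Longrightarrow> x < t \<Longrightarrow> a' x \<ge> 0"
  shows "energy e a W W' s \<le> energy e a W W' t"
proof (rule DERIV_nonneg_imp_increasing_open[OF \<open>s \<le> t\<close>])
  fix x assume x: "s < x" "x < t"
  have "(energy e a W W' has_real_derivative a' x * (norm (W x))\<^sup>2) (at x)"
    using sol x \<open>e \<noteq> 0\<close> by (intro energy_deriv a) (auto simp: semiclassical_solution_def)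
  thus "\<exists>y. (energy e a W W' has_real_derivative y) (at x) \<and> 0 \<le> y"
    using pos[OF x] by auto
qed (rule continuous_on_energy[OF sol cont])

text \<open>
  Where $a$ is bounded away from zero, $|a'| |W|^2$ is at most a constant times the energy, with a
  constant that does not depend on $e$: away from the turning point the energy keeps its order of
  magnitude as $e \to 0$.
\<close>
lemma energy_comparable_endpoints:
  assumes sol: "semiclassical_solution e a s t W W'" and "s \<le> t" "e \<noteq> 0"
    and cont: "continuous_on {s..t} a"
    and a: "\<And>x. s < x \<Longrightarrow> x < t \<Longrightarrow> (a has_real_derivative a' x) (at x)"
    and L: "\<And>x. s < x \<Longrightarrow> x < t \<Longrightarrow> \<bar>a' x\<bar> \<le> L"
    and \<alpha>: "\<alpha> > 0" "\<And>x. s < x \<Longrightarrow> x < t \<Longrightarrow> \<alpha> \<le> a x"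
  shows "energy e a W W' t \<le> exp (L / \<alpha> * (t - s)) * energy e a W W' s"
    and "energy e a W W' s \<le> exp (L / \<alpha> * (t - s)) * energy e a W W' t"
proof -
  have d: "(energy e a W W' has_real_derivative a' x * (norm (W x))\<^sup>2) (at x)" if x: "s < x" "x < t" for x
    using sol x \<open>e \<noteq> 0\<close> by (intro energy_deriv a) (auto simp: semiclassical_solution_def)
  have k: "((\<lambda>x. L / \<alpha> * x) has_real_derivative L / \<alpha>) (at x)" for x
    using \<alpha>(1) by (auto intro!: derivative_eq_intros)
  have le: "\<bar>a' x * (norm (W x))\<^sup>2\<bar> \<le> L / \<alpha> * energy e a W W' x" if x: "s < x" "x < t" for x
  proof -
    have L0: "L \<ge> 0" using L[OF x] by linarith
    have "\<alpha> * (norm (W x))\<^sup>2 \<le> energy e a W W' x"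
      unfolding energy_def using \<alpha>(2)[OF x] by (intro add_increasing mult_right_mono) auto
    hence "(L / \<alpha>) * (\<alpha> * (norm (W x))\<^sup>2) \<le> (L / \<alpha>) * energy e a W W' x"
      using L0 \<alpha>(1) by (intro mult_left_mono) auto
    moreover have "\<bar>a' x * (norm (W x))\<^sup>2\<bar> \<le> L * (norm (W x))\<^sup>2"
      using L[OF x] by (simp add: abs_mult mult_right_mono)
    ultimately show ?thesis using \<alpha>(1) by simp
  qed
  have "continuous_on {s..t} (\<lambda>x. L / \<alpha> * x)" by (intro continuous_intros)
  note G = gronwall_two_sided[OF \<open>s \<le> t\<close> continuous_on_energy[OF sol cont] this d k le]
  show "energy e a W W' t \<le> exp (L / \<alpha> * (t - s)) * energy e a W W' s"
    using G(1) by (simp only: right_diff_distrib)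
  show "energy e a W W' s \<le> exp (L / \<alpha> * (t - s)) * energy e a W W' t"
    using G(2) by (simp only: right_diff_distrib)
qed

lemma energy_comparable:
  assumes sol: "semiclassical_solution e a s t W W'" and "e \<noteq> 0"
    and cont: "continuous_on {s..t} a"
    and a: "\<And>x. s < x \<Longrightarrow> x < t \<Longrightarrow> (a has_real_derivative a' x) (at x)"
    and L: "\<And>x. s < x \<Longrightarrow> x < t \<Longrightarrow> \<bar>a' x\<bar> \<le> L" "L \<ge> 0"
    and \<alpha>: "\<alpha> > 0" "\<And>x. s \<le> x \<Longrightarrow> x \<le> t \<Longrightarrow> \<alpha> \<le> a x"
    and xy: "x \<in> {s..t}" "y \<in> {s..t}"
  shows "energy e a W W' y \<le> exp (L / \<alpha> * (t - s)) * energy e a W W' x"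
proof -
  have *: "energy e a W W' y \<le> exp (L / \<alpha> * (t - s)) * energy e a W W' x \<and>
        energy e a W W' x \<le> exp (L / \<alpha> * (t - s)) * energy e a W W' y"
    if xy: "s \<le> x" "x \<le> y" "y \<le> t" for x y
  proof -
    have S: "semiclassical_solution e a x y W W'"
      using semiclassical_solution_subset[OF sol] xy by auto
    have c: "continuous_on {x..y} a" using cont by (rule continuous_on_subset) (use xy in auto)
    have E: "energy e a W W' z \<ge> 0" if "z \<in> {s..t}" for z
      unfolding energy_def using \<alpha>(2)[of z] \<alpha>(1) that by (intro add_nonneg_nonneg mult_nonneg_nonneg) auto
    have le: "exp (L / \<alpha> * (y - x)) \<le> exp (L / \<alpha> * (t - s))"
      using \<alpha>(1) L(2) xy by (simp only: exp_le_cancel_iff) (intro mult_left_mono, auto)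
    have "energy e a W W' y \<le> exp (L / \<alpha> * (y - x)) * energy e a W W' x"
      "energy e a W W' x \<le> exp (L / \<alpha> * (y - x)) * energy e a W W' y"
      using energy_comparable_endpoints[OF S \<open>x \<le> y\<close> \<open>e \<noteq> 0\<close> c, of a' L \<alpha>] a L \<alpha> xy by auto
    moreover have "exp (L / \<alpha> * (y - x)) * energy e a W W' x \<le> exp (L / \<alpha> * (t - s)) * energy e a W W' x"
      "exp (L / \<alpha> * (y - x)) * energy e a W W' y \<le> exp (L / \<alpha> * (t - s)) * energy e a W W' y"
      using le E[of x] E[of y] xy by (auto intro!: mult_right_mono)
    ultimately show ?thesis by linarith
  qed
  show ?thesis using *[of x y] *[of y x] xy by (cases "x \<le> y") auto
qed

section \<open>The WKB energy\<close>

text \<open>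
  This is $|y|^2 + |dy/d\xi|^2$ for the Liouville transform $y = a^{1/4} W$ with phase variable
  $d\xi = a^{1/2}\,dx / e$, in which the equation becomes $y'' + (1 + \rho) y = 0$ with small $\rho$. In
  contrast to the classical energy it knows the amplitude $a^{-1/4}$, which is what produces the
  exponent $1/6$.
\<close>
definition wkb_energy ::
    "real \<Rightarrow> (real \<Rightarrow> real) \<Rightarrow> (real \<Rightarrow> real) \<Rightarrow> (real \<Rightarrow> 'a::real_inner) \<Rightarrow> (real \<Rightarrow> 'a) \<Rightarrow> real \<Rightarrow> real" where
  "wkb_energy e a a' W W' x = sqrt (a x) * (norm (W x))\<^sup>2 +
     e\<^sup>2 / sqrt (a x) * (norm (W' x + (a' x / (4 * a x)) *\<^sub>R W x))\<^sup>2"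

text \<open>
  With $p = a'/(4a)$ and $P = W' + pW$ one has $P' = -(a/e^2) W + pP + (p' - p^2) W$; all terms cancel
  except the last one, and $p' - p^2 = a''/(4a) - 5a'^2/(16a^2)$.
\<close>
lemma wkb_energy_deriv:
  assumes W: "(W has_vector_derivative W' x) (at x)"
    and W': "(W' has_vector_derivative (- (a x / e\<^sup>2)) *\<^sub>R W x) (at x)"
    and a: "(a has_real_derivative a' x) (at x)" and a': "(a' has_real_derivative a'') (at x)"
    and "e \<noteq> 0" "a x > 0"
  shows "(wkb_energy e a a' W W' has_real_derivative
            2 * e\<^sup>2 / sqrt (a x) * (a'' / (4 * a x) - 5 * (a' x)\<^sup>2 / (16 * (a x)\<^sup>2)) *
            ((W' x + (a' x / (4 * a x)) *\<^sub>R W x) \<bullet> W x)) (at x)"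
proof -
  define p where "p = (\<lambda>x. a' x / (4 * a x))"
  define q where "q = a'' / (4 * a x) - (a' x)\<^sup>2 / (4 * (a x)\<^sup>2)"
  define P where "P = (\<lambda>x. W' x + p x *\<^sub>R W x)"
  define r where "r = sqrt (a x)"
  have r: "r > 0" "r * r = a x" "r\<^sup>2 = a x" using \<open>a x > 0\<close> by (auto simp: r_def)
  have dp: "(p has_real_derivative q) (at x)"
    unfolding p_def q_def using \<open>a x > 0\<close>
    by (auto intro!: derivative_eq_intros a a' simp: field_simps power2_eq_square)
  have dP: "(P has_vector_derivative (- (a x / e\<^sup>2)) *\<^sub>R W x + (p x *\<^sub>R W' x + q *\<^sub>R W x)) (at x)"
    unfolding P_def by (intro has_vector_derivative_add W' has_vector_derivative_scaleR dp W)
  have ds: "((\<lambda>x. sqrt (a x)) has_real_derivative 2 * p x * r) (at x)"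
    using DERIV_real_sqrt[of "a x"] \<open>a x > 0\<close> r
    by (auto intro!: derivative_eq_intros a simp: p_def r_def[symmetric] field_simps)
  have di: "((\<lambda>x. e\<^sup>2 / sqrt (a x)) has_real_derivative - 2 * p x * e\<^sup>2 / r) (at x)"
  proof -
    have "((\<lambda>x. e\<^sup>2 / sqrt (a x)) has_real_derivative
        (0 * sqrt (a x) - e\<^sup>2 * (2 * p x * r)) / (sqrt (a x) * sqrt (a x))) (at x)"
      using \<open>a x > 0\<close> by (intro DERIV_divide DERIV_const ds) auto
    also have "(0 * sqrt (a x) - e\<^sup>2 * (2 * p x * r)) / (sqrt (a x) * sqrt (a x)) = - 2 * p x * e\<^sup>2 / r"
      using r(1) unfolding r_def[symmetric] by (simp add: field_simps)
    finally show ?thesis .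
  qed
  have "((\<lambda>x. sqrt (a x) * (W x \<bullet> W x) + e\<^sup>2 / sqrt (a x) * (P x \<bullet> P x)) has_real_derivative
      (2 * p x * r * (W x \<bullet> W x) + (W x \<bullet> W' x + W' x \<bullet> W x) * sqrt (a x)) +
      (- 2 * p x * e\<^sup>2 / r * (P x \<bullet> P x) +
        (P x \<bullet> ((- (a x / e\<^sup>2)) *\<^sub>R W x + (p x *\<^sub>R W' x + q *\<^sub>R W x)) +
         ((- (a x / e\<^sup>2)) *\<^sub>R W x + (p x *\<^sub>R W' x + q *\<^sub>R W x)) \<bullet> P x) * (e\<^sup>2 / sqrt (a x)))) (at x)"
    by (intro DERIV_add DERIV_mult ds di has_real_derivative_inner W dP)
  also have "(2 * p x * r * (W x \<bullet> W x) + (W x \<bullet> W' x + W' x \<bullet> W x) * sqrt (a x)) +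
      (- 2 * p x * e\<^sup>2 / r * (P x \<bullet> P x) +
        (P x \<bullet> ((- (a x / e\<^sup>2)) *\<^sub>R W x + (p x *\<^sub>R W' x + q *\<^sub>R W x)) +
         ((- (a x / e\<^sup>2)) *\<^sub>R W x + (p x *\<^sub>R W' x + q *\<^sub>R W x)) \<bullet> P x) * (e\<^sup>2 / sqrt (a x)))
     = 2 * e\<^sup>2 / r * (q - (p x)\<^sup>2) * (P x \<bullet> W x)"
  proof -
    have W'P: "W' x = P x - p x *\<^sub>R W x" by (simp add: P_def)
    define A where "A = W x \<bullet> W x"
    define Bv where "Bv = P x \<bullet> W x"
    define Cv where "Cv = P x \<bullet> P x"
    have "W x \<bullet> W' x + W' x \<bullet> W x = 2 * (Bv - p x * A)"
      unfolding W'P by (simp add: inner_diff_left inner_diff_right inner_commute Bv_def A_def)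
    moreover have "P x \<bullet> ((- (a x / e\<^sup>2)) *\<^sub>R W x + (p x *\<^sub>R W' x + q *\<^sub>R W x)) +
         ((- (a x / e\<^sup>2)) *\<^sub>R W x + (p x *\<^sub>R W' x + q *\<^sub>R W x)) \<bullet> P x
        = 2 * (- (a x / e\<^sup>2) * Bv + p x * (Cv - p x * Bv) + q * Bv)"
      unfolding W'P by (simp add: inner_diff_left inner_diff_right inner_add_left inner_add_right
          inner_commute Bv_def Cv_def algebra_simps)
    moreover have "2 * p x * r * A + 2 * (Bv - p x * A) * r + (- 2 * p x * e\<^sup>2 / r * Cv +
        2 * (- (a x / e\<^sup>2) * Bv + p x * (Cv - p x * Bv) + q * Bv) * (e\<^sup>2 / r)) =
        2 * e\<^sup>2 / r * (q - (p x)\<^sup>2) * Bv"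
      using r(1) \<open>e \<noteq> 0\<close> unfolding r(3)[symmetric] by (simp add: field_simps power2_eq_square)
    ultimately show ?thesis
      unfolding r_def[symmetric] A_def[symmetric] Bv_def[symmetric] Cv_def[symmetric] by simp
  qed
  also have "q - (p x)\<^sup>2 = a'' / (4 * a x) - 5 * (a' x)\<^sup>2 / (16 * (a x)\<^sup>2)"
    using \<open>a x > 0\<close> by (simp add: q_def p_def power_divide power_mult_distrib field_simps)
  finally show ?thesis
    unfolding wkb_energy_def[abs_def] power2_norm_eq_inner r_def P_def p_def .
qed

lemma wkb_energy_deriv_bound:
  assumes "e > 0" "a x > 0"
  shows "\<bar>2 * e\<^sup>2 / sqrt (a x) * c * ((W' x + (a' x / (4 * a x)) *\<^sub>R W x) \<bullet> W x)\<bar>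
      \<le> e / sqrt (a x) * \<bar>c\<bar> * wkb_energy e a a' W W' x"
proof -
  define P where "P = W' x + (a' x / (4 * a x)) *\<^sub>R W x"
  define r where "r = sqrt (sqrt (a x))"
  have r: "r > 0" "r * r = sqrt (a x)" using assms by (auto simp: r_def)
  have "2 * e * \<bar>P \<bullet> W x\<bar> \<le> 2 * e * (norm P * norm (W x))"
    using Cauchy_Schwarz_ineq2[of P "W x"] \<open>e > 0\<close> by simp
  \<comment> \<open>Weights $r = a^{1/4}$ turn the product into the mixed term of the two parts of the WKB energy.\<close>
  also have "\<dots> = 2 * (r * norm (W x)) * (e / r * norm P)"
    using r by (simp add: field_simps)
  also have "\<dots> \<le> (r * norm (W x))\<^sup>2 + (e / r * norm P)\<^sup>2"
    using zero_le_power2[of "r * norm (W x) - e / r * norm P"] unfolding power2_diff by linarith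
  also have "\<dots> = wkb_energy e a a' W W' x"
    unfolding wkb_energy_def P_def[symmetric] r(2)[symmetric]
    by (simp add: power_mult_distrib power_divide power2_eq_square)
  finally have le: "2 * e * \<bar>P \<bullet> W x\<bar> \<le> wkb_energy e a a' W W' x" .
  have "\<bar>2 * e\<^sup>2 / sqrt (a x) * c * (P \<bullet> W x)\<bar> = (e / sqrt (a x) * \<bar>c\<bar>) * (2 * e * \<bar>P \<bullet> W x\<bar>)"
    using assms by (simp add: abs_mult abs_divide power2_eq_square)
  also have "\<dots> \<le> (e / sqrt (a x) * \<bar>c\<bar>) * wkb_energy e a a' W W' x"
    using le assms by (intro mult_left_mono) auto
  finally show ?thesis unfolding P_def .
qed

lemma norm_sq_add_le: "(norm (u + v))\<^sup>2 \<le> 2 * (norm u)\<^sup>2 + 2 * (norm v)\<^sup>2"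
proof -
  have "(norm (u + v))\<^sup>2 \<le> (norm u + norm v)\<^sup>2"
    by (intro power_mono norm_triangle_ineq) auto
  also have "\<dots> \<le> 2 * (norm u)\<^sup>2 + 2 * (norm v)\<^sup>2"
    using zero_le_power2[of "norm u - norm v"] unfolding power2_diff power2_sum by linarith
  finally show ?thesis .
qed

text \<open>
  At a fixed point with $a > 0$ the two energies differ only by the term with $a'/(4a)$, so this
  estimate and its converse compare them with factors that stay bounded as $e \to 0$.
\<close>
lemma wkb_energy_le_energy:
  assumes "a x > 0"
  shows "wkb_energy e a a' W W' x
      \<le> (2 + 2 * e\<^sup>2 * (a' x / (4 * a x))\<^sup>2 / a x) / sqrt (a x) * energy e a W W' x"
proof -
  define p where "p = a' x / (4 * a x)"
  define r where "r = sqrt (a x)"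
  have r: "r > 0" "a x = r\<^sup>2" using assms by (auto simp: r_def)
  define A where "A = (norm (W x))\<^sup>2"
  define B where "B = (norm (W' x))\<^sup>2"
  have AB: "A \<ge> 0" "B \<ge> 0" by (auto simp: A_def B_def)
  have "(norm (W' x + p *\<^sub>R W x))\<^sup>2 \<le> 2 * B + 2 * (p\<^sup>2 * A)"
    using norm_sq_add_le[of "W' x" "p *\<^sub>R W x"] by (simp add: A_def B_def power_mult_distrib)
  hence "wkb_energy e a a' W W' x \<le> r * A + e\<^sup>2 / r * (2 * B + 2 * (p\<^sup>2 * A))"
    unfolding wkb_energy_def p_def[symmetric] r_def[symmetric] A_def[symmetric] using r
    by (intro add_left_mono mult_left_mono) auto
  also have "\<dots> \<le> (2 + 2 * e\<^sup>2 * p\<^sup>2 / r\<^sup>2) / r * (e\<^sup>2 * B + r\<^sup>2 * A)"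
  proof -
    have "(2 + 2 * e\<^sup>2 * p\<^sup>2 / r\<^sup>2) / r * (e\<^sup>2 * B + r\<^sup>2 * A)
        = r * A + e\<^sup>2 / r * (2 * B + 2 * (p\<^sup>2 * A)) + (r * A + 2 * e\<^sup>2 * p\<^sup>2 * e\<^sup>2 * B / (r\<^sup>2 * r))"
      using r by (simp add: field_simps power2_eq_square)
    moreover have "r * A + 2 * e\<^sup>2 * p\<^sup>2 * e\<^sup>2 * B / (r\<^sup>2 * r) \<ge> 0"
      using r AB by (intro add_nonneg_nonneg mult_nonneg_nonneg divide_nonneg_nonneg) auto
    ultimately show ?thesis by linarith
  qed
  finally show ?thesis
    unfolding energy_def p_def r(2)[symmetric] A_def B_def unfolding r_def .
qed

lemma energy_le_wkb_energy:
  assumes "a x > 0"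
  shows "energy e a W W' x
      \<le> (2 * a x + 2 * e\<^sup>2 * (a' x / (4 * a x))\<^sup>2) / sqrt (a x) * wkb_energy e a a' W W' x"
proof -
  define p where "p = a' x / (4 * a x)"
  define r where "r = sqrt (a x)"
  have r: "r > 0" "a x = r\<^sup>2" using assms by (auto simp: r_def)
  define A where "A = (norm (W x))\<^sup>2"
  define B where "B = (norm (W' x + p *\<^sub>R W x))\<^sup>2"
  have AB: "A \<ge> 0" "B \<ge> 0" by (auto simp: A_def B_def)
  have "(norm (W' x))\<^sup>2 \<le> 2 * B + 2 * (p\<^sup>2 * A)"
    using norm_sq_add_le[of "W' x + p *\<^sub>R W x" "- (p *\<^sub>R W x)"]
    by (simp add: A_def B_def power_mult_distrib)
  hence "energy e a W W' x \<le> e\<^sup>2 * (2 * B + 2 * (p\<^sup>2 * A)) + r\<^sup>2 * A"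
    unfolding energy_def r(2) A_def[symmetric]
    by (intro add_right_mono mult_left_mono) auto
  also have "\<dots> \<le> (2 * r\<^sup>2 + 2 * e\<^sup>2 * p\<^sup>2) / r * (r * A + e\<^sup>2 / r * B)"
  proof -
    have "(2 * r\<^sup>2 + 2 * e\<^sup>2 * p\<^sup>2) / r * (r * A + e\<^sup>2 / r * B)
        = e\<^sup>2 * (2 * B + 2 * (p\<^sup>2 * A)) + r\<^sup>2 * A + (r\<^sup>2 * A + 2 * e\<^sup>2 * p\<^sup>2 * e\<^sup>2 * B / r\<^sup>2)"
      using r by (simp add: field_simps power2_eq_square)
    moreover have "r\<^sup>2 * A + 2 * e\<^sup>2 * p\<^sup>2 * e\<^sup>2 * B / r\<^sup>2 \<ge> 0"
      using r AB by (intro add_nonneg_nonneg mult_nonneg_nonneg divide_nonneg_nonneg) auto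
    ultimately show ?thesis by linarith
  qed
  finally show ?thesis
    unfolding wkb_energy_def p_def r(2)[symmetric] A_def B_def unfolding r_def .
qed

section \<open>Solutions near a simple turning point\<close>

text \<open>
  The turning point sits at $0$, where $a$ vanishes linearly with slope between $m$ and $M$.
\<close>
locale simple_turning_point =
  fixes a a' a'' :: "real \<Rightarrow> real" and d m M B :: real
  assumes d: "d > 0" and m: "m > 0"
    and deriv_a: "\<And>x. 0 \<le> x \<Longrightarrow> x \<le> d \<Longrightarrow> (a has_real_derivative a' x) (at x)"
    and deriv_a': "\<And>x. 0 \<le> x \<Longrightarrow> x \<le> d \<Longrightarrow> (a' has_real_derivative a'' x) (at x)"
    and a_lower: "\<And>x. 0 \<le> x \<Longrightarrow> x \<le> d \<Longrightarrow> m * x \<le> a x"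
    and a_upper: "\<And>x. 0 \<le> x \<Longrightarrow> x \<le> d \<Longrightarrow> a x \<le> M * x"
    and a'_nonneg: "\<And>x. 0 \<le> x \<Longrightarrow> x \<le> d \<Longrightarrow> 0 \<le> a' x"
    and a'_upper: "\<And>x. 0 \<le> x \<Longrightarrow> x \<le> d \<Longrightarrow> a' x \<le> M"
    and a''_bound: "\<And>x. 0 \<le> x \<Longrightarrow> x \<le> d \<Longrightarrow> \<bar>a'' x\<bar> \<le> B"
begin

lemma M_pos: "M > 0"
  using a_lower[of d] a_upper[of d] d m
  by (smt (verit) mult_le_cancel_right_pos)

lemma B_nonneg: "B \<ge> 0"
  using a''_bound[of d] d by auto

lemma a_pos: "0 < x \<Longrightarrow> x \<le> d \<Longrightarrow> a x > 0"
  using a_lower[of x] m by (smt (verit) mult_pos_pos)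

lemma a_nonneg: "0 \<le> x \<Longrightarrow> x \<le> d \<Longrightarrow> a x \<ge> 0"
  using a_lower[of x] m by (smt (verit) mult_nonneg_nonneg)

lemma cont_a: "continuous_on {0..d} a"
  by (rule DERIV_continuous_on) (use deriv_a in \<open>auto intro: has_field_derivative_at_within\<close>)

lemma cont_a': "continuous_on {0..d} a'"
  by (rule DERIV_continuous_on) (use deriv_a' in \<open>auto intro: has_field_derivative_at_within\<close>)

text \<open>
  A bound for the total logarithmic variation of the WKB energy between the edge of the turning point
  layer and \<open>d\<close>.
\<close>
definition wkb_error :: real where
  "wkb_error = (B * M * d / 4 + 5 * M\<^sup>2 / 16) / (m\<^sup>2 * sqrt m)"

lemma wkb_error_nonneg: "wkb_error \<ge> 0"
  unfolding wkb_error_def using M_pos B_nonneg d m by auto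

text \<open>
  Since $a$ is comparable to $x$, the relative rate of change of the WKB energy is
  $O(e\, a^{-1/2} a^{-2}) = O(e\, x^{-5/2})$.
\<close>
lemma wkb_error_bound:
  assumes "0 < x" "x \<le> d" "e > 0"
  shows "e / sqrt (a x) * \<bar>a'' x / (4 * a x) - 5 * (a' x)\<^sup>2 / (16 * (a x)\<^sup>2)\<bar>
      \<le> wkb_error * e * x powr (- 5 / 2)"
proof -
  have ax: "a x > 0" "m * x \<le> a x" "a x \<le> M * x" "0 \<le> a' x" "a' x \<le> M" "\<bar>a'' x\<bar> \<le> B"
    using assms by (auto intro: a_pos a_lower a_upper a'_nonneg a'_upper a''_bound)
  define C where "C = B * M * d / 4 + 5 * M\<^sup>2 / 16"
  have C: "C \<ge> 0" unfolding C_def using M_pos B_nonneg d by auto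
  have "a x \<le> M * d" using ax(3) mult_left_mono[of x d M] M_pos assms by linarith
  hence 1: "\<bar>a'' x\<bar> * a x \<le> B * (M * d)"
    using ax B_nonneg by (intro mult_mono) auto
  have 2: "(a' x)\<^sup>2 \<le> M\<^sup>2" using ax by (intro power_mono) auto
  have "\<bar>a'' x / (4 * a x) - 5 * (a' x)\<^sup>2 / (16 * (a x)\<^sup>2)\<bar>
     \<le> \<bar>a'' x / (4 * a x)\<bar> + \<bar>5 * (a' x)\<^sup>2 / (16 * (a x)\<^sup>2)\<bar>"
    by (rule abs_triangle_ineq4)
  also have "\<dots> = (\<bar>a'' x\<bar> * a x / 4 + 5 * (a' x)\<^sup>2 / 16) / (a x)\<^sup>2"
    using ax(1) by (simp add: abs_divide field_simps power2_eq_square)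
  also have "\<dots> \<le> C / (a x)\<^sup>2"
    using 1 2 by (intro divide_right_mono) (auto simp: C_def)
  also have "\<dots> \<le> C / (m * x)\<^sup>2"
    using ax C m assms by (intro divide_left_mono power_mono mult_pos_pos) auto
  finally have "e / sqrt (a x) * \<bar>a'' x / (4 * a x) - 5 * (a' x)\<^sup>2 / (16 * (a x)\<^sup>2)\<bar>
     \<le> e / sqrt (m * x) * (C / (m * x)\<^sup>2)"
    using ax m assms C by (intro mult_mono divide_left_mono) auto
  also have "\<dots> = wkb_error * e * (1 / (x\<^sup>2 * sqrt x))"
    using m assms unfolding wkb_error_def C_def[symmetric]
    by (simp add: real_sqrt_mult power_mult_distrib field_simps)
  also have "1 / (x\<^sup>2 * sqrt x) = x powr (- 5 / 2)"
  proof -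
    have "x\<^sup>2 * sqrt x = x powr (2 + 1 / 2)"
      using assms by (simp only: powr_add) (simp add: powr_half_sqrt)
    thus ?thesis using assms by (simp add: powr_minus_divide)
  qed
  finally show ?thesis .
qed

text \<open>
  Put $e = h^6$. The rate $e\,x^{-5/2}$ integrates over $x \ge x_0$ to a multiple of $e\,x_0^{-3/2}$, which
  is bounded precisely when $x_0$ is at least of the order $e^{2/3} = h^4$, the width of the turning point
  layer. Outside the layer the WKB energy is therefore of one order of magnitude. Writing $e$ as $h^6$
  makes all exponents integers.
\<close>
lemma wkb_energy_comparable:
  assumes sol: "semiclassical_solution (h ^ 6) a 0 d W W'"
    and h: "h > 0" and x: "h ^ 4 \<le> x" "x \<le> d"
  shows "wkb_energy (h ^ 6) a a' W W' d \<le> exp wkb_error * wkb_energy (h ^ 6) a a' W W' x"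
    and "wkb_energy (h ^ 6) a a' W W' x \<le> exp wkb_error * wkb_energy (h ^ 6) a a' W W' d"
proof -
  have x0: "x > 0" using h x by (smt (verit) zero_less_power)
  define K where "K = (\<lambda>y. - (2 / 3) * wkb_error * h ^ 6 * y powr (- 3 / 2))"
  define c where "c = (\<lambda>y. a'' y / (4 * a y) - 5 * (a' y)\<^sup>2 / (16 * (a y)\<^sup>2))"
  define g' where "g' = (\<lambda>y. 2 * (h ^ 6)\<^sup>2 / sqrt (a y) * c y *
            ((W' y + (a' y / (4 * a y)) *\<^sub>R W y) \<bullet> W y))"
  have dK: "(K has_real_derivative wkb_error * h ^ 6 * y powr (- 5 / 2)) (at y)" if "x < y" for y
  proof -
    have "((\<lambda>y. y powr (- 3 / 2)) has_real_derivative (- 3 / 2) * y powr (- 3 / 2 - 1)) (at y)"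
      using has_real_derivative_powr[of y "- 3 / 2"] that x0 by simp
    from DERIV_cmult[OF this, of "- (2 / 3) * wkb_error * h ^ 6"] show ?thesis
      by (simp add: K_def mult.assoc)
  qed
  have dg: "(wkb_energy (h ^ 6) a a' W W' has_real_derivative g' y) (at y)" if "x < y" "y < d" for y
    unfolding g'_def c_def using sol that x0 h
    by (intro wkb_energy_deriv deriv_a deriv_a' a_pos) (auto simp: semiclassical_solution_def)
  have le: "\<bar>g' y\<bar> \<le> wkb_error * h ^ 6 * y powr (- 5 / 2) * wkb_energy (h ^ 6) a a' W W' y"
    if "x < y" "y < d" for y
  proof -
    have ay: "a y > 0" using a_pos that x0 by simp
    have "\<bar>g' y\<bar> \<le> h ^ 6 / sqrt (a y) * \<bar>c y\<bar> * wkb_energy (h ^ 6) a a' W W' y"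
      unfolding g'_def using h ay by (intro wkb_energy_deriv_bound) auto
    also have "\<dots> \<le> wkb_error * h ^ 6 * y powr (- 5 / 2) * wkb_energy (h ^ 6) a a' W W' y"
      unfolding c_def using that x0 h ay
      by (intro mult_right_mono wkb_error_bound) (auto simp: wkb_energy_def)
    finally show ?thesis .
  qed
  have sub: "{x..d} \<subseteq> {0..d}" using x0 by auto
  have cW: "continuous_on {x..d} W" "continuous_on {x..d} W'"
    using sol sub unfolding semiclassical_solution_def by (auto intro: continuous_on_subset)
  have ca: "continuous_on {x..d} a" "continuous_on {x..d} a'"
    using cont_a cont_a' sub by (auto intro: continuous_on_subset)
  have pos: "a y > 0" if "y \<in> {x..d}" for y using a_pos that x0 by auto
  have "continuous_on {x..d} (wkb_energy (h ^ 6) a a' W W')"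
    unfolding wkb_energy_def[abs_def]
    by (intro continuous_intros cW ca) (use pos in \<open>auto dest: less_imp_neq[OF pos]\<close>)
  moreover have "continuous_on {x..d} K"
    unfolding K_def by (intro continuous_intros) (use x0 in auto)
  ultimately have
    G: "wkb_energy (h ^ 6) a a' W W' d \<le> exp (K d - K x) * wkb_energy (h ^ 6) a a' W W' x"
      "wkb_energy (h ^ 6) a a' W W' x \<le> exp (K d - K x) * wkb_energy (h ^ 6) a a' W W' d"
    using gronwall_two_sided[OF \<open>x \<le> d\<close> _ _ dg dK le] by blast+
  have "K d - K x \<le> wkb_error"
  proof -
    have "x powr (- 3 / 2) \<le> (h ^ 4) powr (- 3 / 2)"
      using h x by (intro powr_mono2') auto
    also have "\<dots> = 1 / h ^ 6"
    proof -
      have "(h ^ 4) powr (- 3 / 2) = (h powr 4) powr (- 3 / 2)" using h by simp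
      also have "\<dots> = h powr (- 6)" unfolding powr_powr by simp
      also have "\<dots> = 1 / h ^ 6" using h by (simp add: powr_minus_divide)
      finally show ?thesis .
    qed
    finally have "(2 / 3 * wkb_error * h ^ 6) * x powr (- 3 / 2) \<le> (2 / 3 * wkb_error * h ^ 6) * (1 / h ^ 6)"
      using wkb_error_nonneg h by (intro mult_left_mono) auto
    hence "- K x \<le> 2 / 3 * wkb_error" using h by (simp add: K_def)
    moreover have "K d \<le> 0" unfolding K_def using wkb_error_nonneg h by simp
    ultimately show ?thesis using wkb_error_nonneg by simp
  qed
  hence le: "exp (K d - K x) \<le> exp wkb_error" by simp
  have G0: "wkb_energy (h ^ 6) a a' W W' y \<ge> 0" if "x \<le> y" "y \<le> d" for y
    unfolding wkb_energy_def using pos[of y] that by simp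
  show "wkb_energy (h ^ 6) a a' W W' d \<le> exp wkb_error * wkb_energy (h ^ 6) a a' W W' x"
    "wkb_energy (h ^ 6) a a' W W' x \<le> exp wkb_error * wkb_energy (h ^ 6) a a' W W' d"
    using G mult_right_mono[OF le G0[of x]] mult_right_mono[OF le G0[of d]] x by linarith+
qed

end

lemma norm_diff_le_deriv_bound:
  fixes f :: "real \<Rightarrow> 'a::real_inner"
  assumes "s \<le> t" and cont: "continuous_on {s..t} f"
    and f: "\<And>x. s < x \<Longrightarrow> x < t \<Longrightarrow> (f has_vector_derivative f' x) (at x)"
    and K: "\<And>x. s < x \<Longrightarrow> x < t \<Longrightarrow> norm (f' x) \<le> K"
  shows "norm (f t - f s) \<le> K * (t - s)"
proof (cases "s = t")
  case False
  hence "s < t" using \<open>s \<le> t\<close> by simp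
  obtain x where x: "x \<in> {s<..<t}" "norm (f t - f s) \<le> norm ((t - s) *\<^sub>R f' x)"
    using mvt_general[OF \<open>s < t\<close> cont, of "\<lambda>x h. h *\<^sub>R f' x"] f
    unfolding has_vector_derivative_def by blast
  have "norm ((t - s) *\<^sub>R f' x) = (t - s) * norm (f' x)"
    using \<open>s < t\<close> by simp
  also have "\<dots> \<le> (t - s) * K"
    using \<open>s < t\<close> K[of x] x(1) by (intro mult_left_mono) auto
  finally show ?thesis using x(2) by (simp add: mult.commute)
qed simp

context simple_turning_point
begin

lemma slope_bound:
  assumes "0 < h" "h ^ 4 \<le> d"
  shows "0 \<le> a' (h ^ 4) / (4 * a (h ^ 4))" "a' (h ^ 4) / (4 * a (h ^ 4)) \<le> M / (4 * m) / h ^ 4"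
proof -
  have x: "0 < h ^ 4" "0 \<le> h ^ 4" using assms by auto
  show "0 \<le> a' (h ^ 4) / (4 * a (h ^ 4))"
    using a'_nonneg[of "h ^ 4"] a_pos[of "h ^ 4"] assms x by auto
  have "a' (h ^ 4) / (4 * a (h ^ 4)) \<le> M / (4 * (m * h ^ 4))"
    using a'_upper[of "h ^ 4"] a'_nonneg[of "h ^ 4"] a_lower[of "h ^ 4"] assms x m
    by (intro frac_le) auto
  thus "a' (h ^ 4) / (4 * a (h ^ 4)) \<le> M / (4 * m) / h ^ 4" by (simp add: mult.assoc)
qed

lemma sqrt_a_bounds:
  assumes "0 < h" "h ^ 4 \<le> x" "x \<le> d"
  shows "sqrt m * h\<^sup>2 \<le> sqrt (a x)"
    and "sqrt (a (h ^ 4)) \<le> sqrt M * h\<^sup>2"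
proof -
  have h: "0 < h ^ 4" using assms by auto
  have s: "sqrt (h ^ 4) = h\<^sup>2" by (rule real_sqrt_unique) auto
  have "m * h ^ 4 \<le> m * x" using m assms by simp
  also have "\<dots> \<le> a x" using a_lower[of x] assms h by auto
  finally have "sqrt (m * h ^ 4) \<le> sqrt (a x)" by simp
  thus "sqrt m * h\<^sup>2 \<le> sqrt (a x)" by (simp only: real_sqrt_mult s)
  have "a (h ^ 4) \<le> M * h ^ 4" using a_upper[of "h ^ 4"] assms h by auto
  hence "sqrt (a (h ^ 4)) \<le> sqrt (M * h ^ 4)" by simp
  thus "sqrt (a (h ^ 4)) \<le> sqrt M * h\<^sup>2" by (simp only: real_sqrt_mult s)
qed

text \<open>
  Outside the layer a bounded WKB energy gives $|W| \le C a^{-1/4} \le C/h$ because $a \ge m h^4$. At the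
  edge $h^4$ of the layer it also gives $|W'| \le C h^{-5}$, so that the classical energy there is
  $O(h^2)$. Within the layer the classical energy is increasing, hence $|W'| \le C h^{-5}$ throughout,
  and over the width $h^4$ the function changes by $O(1/h)$ only.
\<close>
theorem turning_point_upper:
  assumes N: "N \<ge> 0"
  shows "\<exists>C>0. \<forall>h (W :: real \<Rightarrow> 'a::real_inner) W'. 0 < h \<longrightarrow> h \<le> 1 \<longrightarrow> h ^ 4 \<le> d \<longrightarrow>
           semiclassical_solution (h ^ 6) a 0 d W W' \<longrightarrow> energy (h ^ 6) a W W' d \<le> N \<longrightarrow>
           (\<forall>x\<in>{0..d}. norm (W x) \<le> C / h)"
proof -
  define p where "p = a' d / (4 * a d)"
  define c0 where "c0 = (2 + 2 * p\<^sup>2 / a d) / sqrt (a d)"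
  define g where "g = exp wkb_error * (c0 * N)"
  define c1 where "c1 = sqrt (g / sqrt m)"
  define c2 where "c2 = sqrt (g * sqrt M)"
  define c3 where "c3 = c2 + M / (4 * m) * c1"
  define c4 where "c4 = sqrt (c3\<^sup>2 + M * c1\<^sup>2)"
  have ad: "a d > 0" using a_pos d by simp
  have c0: "c0 \<ge> 0" using ad unfolding c0_def by (intro divide_nonneg_nonneg add_nonneg_nonneg) auto
  have g: "g \<ge> 0" using c0 N by (simp add: g_def)
  have c: "c1 \<ge> 0" "c2 \<ge> 0" "c3 \<ge> 0" "c4 \<ge> 0"
    using g m M_pos by (auto simp: c1_def c2_def c3_def c4_def)
  have "norm (W x) \<le> (c1 + c4 + 1) / h"
    if h: "0 < h" "h \<le> 1" "h ^ 4 \<le> d" and sol: "semiclassical_solution (h ^ 6) a 0 d W W'"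
      and E: "energy (h ^ 6) a W W' d \<le> N" and x: "x \<in> {0..d}"
    for h x and W W' :: "real \<Rightarrow> 'a"
  proof -
    define e where "e = h ^ 6"
    have e: "e > 0" "e \<le> 1" using h by (auto simp: e_def power_le_one)
    have h4: "0 < h ^ 4" using h by simp
    have E0: "energy e a W W' d \<ge> 0" using ad by (simp add: energy_def)
    have "wkb_energy e a a' W W' d \<le> (2 + 2 * e\<^sup>2 * p\<^sup>2 / a d) / sqrt (a d) * energy e a W W' d"
      unfolding p_def by (rule wkb_energy_le_energy[where a = a and x = d, OF ad])
    also have "\<dots> \<le> c0 * energy e a W W' d"
    proof -
      have "2 * e\<^sup>2 * p\<^sup>2 \<le> 2 * 1 * p\<^sup>2"
        using e by (intro mult_right_mono mult_left_mono) (auto simp: power_le_one)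
      hence "(2 + 2 * e\<^sup>2 * p\<^sup>2 / a d) / sqrt (a d) \<le> c0"
        unfolding c0_def using ad by (intro divide_right_mono add_left_mono) auto
      thus ?thesis using E0 by (rule mult_right_mono)
    qed
    also have "\<dots> \<le> c0 * N" using E c0 by (intro mult_left_mono) (auto simp: e_def)
    finally have Gd: "wkb_energy e a a' W W' d \<le> c0 * N" .
    have G: "wkb_energy e a a' W W' y \<le> g" if "h ^ 4 \<le> y" "y \<le> d" for y
    proof -
      have "wkb_energy e a a' W W' y \<le> exp wkb_error * wkb_energy e a a' W W' d"
        using wkb_energy_comparable(2)[OF sol h(1) that] by (simp add: e_def)
      also have "\<dots> \<le> g" unfolding g_def using Gd by simp
      finally show ?thesis .
    qed
    have W1: "norm (W y) \<le> c1 / h" if "h ^ 4 \<le> y" "y \<le> d" for y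
    proof -
      have ay: "a y > 0" using a_pos[of y] h4 that by linarith
      have "sqrt m * h\<^sup>2 * (norm (W y))\<^sup>2 \<le> sqrt (a y) * (norm (W y))\<^sup>2"
        using sqrt_a_bounds(1)[OF h(1) that] by (intro mult_right_mono) auto
      also have "\<dots> \<le> wkb_energy e a a' W W' y"
        unfolding wkb_energy_def using ay by simp
      also have "\<dots> \<le> g" using G that by simp
      finally have "(norm (W y))\<^sup>2 \<le> g / sqrt m / h\<^sup>2"
        using m h by (simp add: field_simps)
      also have "\<dots> = (c1 / h)\<^sup>2"
        using g m by (simp add: c1_def power_divide)
      finally show ?thesis by (rule power2_le_imp_le) (use c h in auto)
    qed
    define P where "P = W' (h ^ 4) + (a' (h ^ 4) / (4 * a (h ^ 4))) *\<^sub>R W (h ^ 4)"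
    have ax0: "a (h ^ 4) > 0" using a_pos h4 h by simp
    have P: "norm P \<le> c2 / h ^ 5"
    proof -
      have "e\<^sup>2 / sqrt (a (h ^ 4)) * (norm P)\<^sup>2 \<le> wkb_energy e a a' W W' (h ^ 4)"
        unfolding wkb_energy_def P_def using ax0 by simp
      also have "\<dots> \<le> g" using G h by simp
      finally have "e\<^sup>2 * (norm P)\<^sup>2 \<le> g * sqrt (a (h ^ 4))"
        using ax0 by (simp add: field_simps)
      also have "\<dots> \<le> g * (sqrt M * h\<^sup>2)"
        using g sqrt_a_bounds(2)[OF h(1) h(3)] by (intro mult_left_mono) auto
      also have "\<dots> = e\<^sup>2 * (g * sqrt M / h ^ 10)"
        using h by (simp add: e_def field_simps eval_nat_numeral)
      also have "\<dots> = e\<^sup>2 * (c2 / h ^ 5)\<^sup>2"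
        using g M_pos by (simp add: c2_def power_divide flip: power_mult)
      finally have "(norm P)\<^sup>2 \<le> (c2 / h ^ 5)\<^sup>2" using e by simp
      thus ?thesis by (rule power2_le_imp_le) (use c h in auto)
    qed
    have W'0: "norm (W' (h ^ 4)) \<le> c3 / h ^ 5"
    proof -
      define q where "q = a' (h ^ 4) / (4 * a (h ^ 4))"
      have "norm (W' (h ^ 4)) = norm (P - q *\<^sub>R W (h ^ 4))" by (simp add: P_def q_def)
      also have "\<dots> \<le> norm P + norm (q *\<^sub>R W (h ^ 4))" by (rule norm_triangle_ineq4)
      also have "norm (q *\<^sub>R W (h ^ 4)) = q * norm (W (h ^ 4))"
        using slope_bound(1)[OF h(1) h(3)] unfolding q_def[symmetric] by simp
      also have "q * norm (W (h ^ 4)) \<le> (M / (4 * m) / h ^ 4) * (c1 / h)"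
        using slope_bound[OF h(1) h(3)] W1[of "h ^ 4"] h m M_pos unfolding q_def
        by (intro mult_mono) auto
      also have "(M / (4 * m) / h ^ 4) * (c1 / h) = M / (4 * m) * c1 / h ^ 5"
        using h by (simp add: eval_nat_numeral)
      finally show ?thesis using P by (simp add: c3_def add_divide_distrib)
    qed
    have W'1: "norm (W' y) \<le> c4 / h ^ 5" if y: "0 \<le> y" "y \<le> h ^ 4" for y
    proof -
      have "e\<^sup>2 * (norm (W' y))\<^sup>2 \<le> energy e a W W' y"
        unfolding energy_def using a_nonneg[of y] y h by simp
      also have "\<dots> \<le> energy e a W W' (h ^ 4)"
      proof (rule energy_mono[where a' = a'])
        show "semiclassical_solution e a y (h ^ 4) W W'"
          using semiclassical_solution_subset[OF sol] y h by (simp add: e_def)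
        show "continuous_on {y..h ^ 4} a"
          using cont_a by (rule continuous_on_subset) (use y h in auto)
      qed (use y h e in \<open>auto intro!: deriv_a a'_nonneg\<close>)
      also have "\<dots> \<le> e\<^sup>2 * (c3 / h ^ 5)\<^sup>2 + (M * h ^ 4) * (c1 / h)\<^sup>2"
        unfolding energy_def using W'0 W1[of "h ^ 4"] h e a_upper[of "h ^ 4"] M_pos
        by (intro add_mono mult_mono power_mono) auto
      also have "\<dots> = e\<^sup>2 * ((c3\<^sup>2 + M * c1\<^sup>2) / h ^ 10)"
        using h by (simp add: e_def power_divide field_simps eval_nat_numeral)
      also have "(c3\<^sup>2 + M * c1\<^sup>2) / h ^ 10 = (c4 / h ^ 5)\<^sup>2"
        using M_pos by (simp add: c4_def power_divide flip: power_mult)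
      finally have "(norm (W' y))\<^sup>2 \<le> (c4 / h ^ 5)\<^sup>2" using e by simp
      thus ?thesis by (rule power2_le_imp_le) (use c h in auto)
    qed
    show ?thesis
    proof (cases "h ^ 4 \<le> x")
      case True
      hence "norm (W x) \<le> c1 / h" using W1 x by auto
      also have "\<dots> \<le> (c1 + c4 + 1) / h" using c h by (intro divide_right_mono) auto
      finally show ?thesis .
    next
      case False
      hence x': "0 \<le> x" "x \<le> h ^ 4" using x by auto
      have "norm (W (h ^ 4) - W x) \<le> c4 / h ^ 5 * (h ^ 4 - x)"
      proof (rule norm_diff_le_deriv_bound[OF x'(2)])
        show "continuous_on {x..h ^ 4} W"
          using sol x' h unfolding semiclassical_solution_def by (auto elim: continuous_on_subset)
        show "(W has_vector_derivative W' y) (at y)" if "x < y" "y < h ^ 4" for y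
          using sol x' h that unfolding semiclassical_solution_def by auto
      qed (use W'1 x' in auto)
      also have "\<dots> \<le> c4 / h ^ 5 * h ^ 4" using c h x' by (intro mult_left_mono) auto
      also have "\<dots> = c4 / h" using h by (simp add: field_simps eval_nat_numeral)
      finally have "norm (W (h ^ 4) - W x) \<le> c4 / h" .
      moreover have "norm (W (h ^ 4)) \<le> c1 / h" using W1 h by auto
      moreover have "norm (W x) \<le> norm (W (h ^ 4)) + norm (W (h ^ 4) - W x)"
        by (metis norm_minus_commute norm_triangle_sub)
      ultimately have "norm (W x) \<le> c1 / h + c4 / h" by linarith
      also have "\<dots> \<le> (c1 + c4 + 1) / h" using h by (simp add: add_divide_distrib)
      finally show ?thesis .
    qed
  qed
  moreover have "c1 + c4 + 1 > 0" using c by linarith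
  ultimately show ?thesis by blast
qed

text \<open>
  At the edge $h^4$ of the layer the WKB energy is bounded below. If $|W| \le c/h$ everywhere with a
  small $c$, it must be carried by the derivative, so $|W'(h^4)| \ge c' h^{-5}$. But then
  $|W''| = a |W| / e^2 \le 2 M c\, h^{-9}$ on $[h^4, 2h^4]$ hardly changes $W'$ there, and $W$ grows by
  about $c'/h$ over an interval of length $h^4$, a contradiction when $c$ is small compared with $c'$.
\<close>
theorem turning_point_lower:
  assumes n: "n > 0"
  shows "\<exists>c>0. \<forall>h (W :: real \<Rightarrow> 'a::real_inner) W'. 0 < h \<longrightarrow> h \<le> 1 \<longrightarrow> 2 * h ^ 4 < d \<longrightarrow>
           semiclassical_solution (h ^ 6) a 0 d W W' \<longrightarrow> n \<le> energy (h ^ 6) a W W' d \<longrightarrow>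
           (\<exists>x\<in>{0<..<d}. c / h \<le> norm (W x))"
proof -
  define p where "p = a' d / (4 * a d)"
  define c0 where "c0 = (2 * a d + 2 * p\<^sup>2) / sqrt (a d)"
  have ad: "a d > 0" using a_pos d by simp
  have c0: "c0 > 0" using ad unfolding c0_def by (intro divide_pos_pos add_pos_nonneg) auto
  define g where "g = n / c0 / exp wkb_error"
  have g: "g > 0" using c0 n by (simp add: g_def)
  define c5 where "c5 = sqrt (g * sqrt m / 2)"
  have c5: "c5 > 0" using g m by (simp add: c5_def)
  define b where "b = 2 + 2 * M + M / (4 * m)"
  have b: "b > 0" using M_pos m unfolding b_def by (intro add_pos_pos) auto
  \<comment> \<open>The first bound makes $b c < c_5$, which the last estimate contradicts; the second one keeps $|W|$
    from carrying more than half of the WKB energy.\<close>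
  define c where "c = min (c5 / (2 * b)) (sqrt (g / (2 * sqrt M)))"
  have c: "c > 0" using c5 b g M_pos by (simp add: c_def)
  have cb: "b * c < c5"
  proof -
    have "b * c \<le> b * (c5 / (2 * b))" using b by (intro mult_left_mono) (auto simp: c_def)
    also have "\<dots> < c5" using b c5 by simp
    finally show ?thesis .
  qed
  have cg: "sqrt M * c\<^sup>2 \<le> g / 2"
  proof -
    have "c\<^sup>2 \<le> (sqrt (g / (2 * sqrt M)))\<^sup>2" using c by (intro power_mono) (auto simp: c_def)
    also have "\<dots> = g / (2 * sqrt M)" using g M_pos by simp
    finally show ?thesis using M_pos by (simp add: field_simps)
  qed
  have "\<exists>x\<in>{0<..<d}. c / h \<le> norm (W x)"
    if h: "0 < h" "h \<le> 1" "2 * h ^ 4 < d" and sol: "semiclassical_solution (h ^ 6) a 0 d W W'"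
      and E: "n \<le> energy (h ^ 6) a W W' d"
    for h and W W' :: "real \<Rightarrow> 'a"
  proof (rule ccontr)
    assume "\<not> ?thesis"
    hence small: "norm (W x) \<le> c / h" if "0 < x" "x < d" for x
      using that by (auto simp: not_le intro: less_imp_le)
    define e where "e = h ^ 6"
    have e: "e > 0" "e \<le> 1" using h by (auto simp: e_def power_le_one)
    have h4: "0 < h ^ 4" using h by simp
    hence hd: "h ^ 4 \<le> d" "h ^ 4 < d" using h(3) by linarith+
    have ax0: "a (h ^ 4) > 0" using a_pos h4 hd by simp
    have G0: "wkb_energy e a a' W W' d \<ge> 0" using ad by (simp add: wkb_energy_def)
    have "n \<le> energy e a W W' d" using E by (simp add: e_def)
    also have "\<dots> \<le> (2 * a d + 2 * e\<^sup>2 * p\<^sup>2) / sqrt (a d) * wkb_energy e a a' W W' d"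
      unfolding p_def by (rule energy_le_wkb_energy[where a = a and x = d, OF ad])
    also have "\<dots> \<le> c0 * wkb_energy e a a' W W' d"
    proof -
      have "2 * e\<^sup>2 * p\<^sup>2 \<le> 2 * 1 * p\<^sup>2"
        using e by (intro mult_right_mono mult_left_mono) (auto simp: power_le_one)
      hence "(2 * a d + 2 * e\<^sup>2 * p\<^sup>2) / sqrt (a d) \<le> c0"
        unfolding c0_def using ad by (intro divide_right_mono add_left_mono) auto
      thus ?thesis using G0 by (rule mult_right_mono)
    qed
    also have "\<dots> \<le> c0 * (exp wkb_error * wkb_energy e a a' W W' (h ^ 4))"
      using wkb_energy_comparable(1)[OF sol h(1) order_refl hd(1)] c0
      by (intro mult_left_mono) (auto simp: e_def)
    finally have G: "g \<le> wkb_energy e a a' W W' (h ^ 4)"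
      using c0 by (simp add: g_def field_simps)
    define q where "q = a' (h ^ 4) / (4 * a (h ^ 4))"
    define P where "P = W' (h ^ 4) + q *\<^sub>R W (h ^ 4)"
    have "sqrt (a (h ^ 4)) * (norm (W (h ^ 4)))\<^sup>2 \<le> (sqrt M * h\<^sup>2) * (c / h)\<^sup>2"
      using sqrt_a_bounds(2)[OF h(1) hd(1)] small[OF h4 hd(2)] M_pos
      by (intro mult_mono power_mono) auto
    also have "\<dots> = sqrt M * c\<^sup>2" using h by (simp add: power_divide)
    finally have "g / 2 \<le> e\<^sup>2 / sqrt (a (h ^ 4)) * (norm P)\<^sup>2"
      using G cg unfolding wkb_energy_def P_def q_def by linarith
    hence "g / 2 * sqrt (a (h ^ 4)) \<le> e\<^sup>2 * (norm P)\<^sup>2"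
      using ax0 by (simp add: field_simps)
    moreover have "g / 2 * (sqrt m * h\<^sup>2) \<le> g / 2 * sqrt (a (h ^ 4))"
      using sqrt_a_bounds(1)[OF h(1) order_refl hd(1)] g by (intro mult_left_mono) auto
    moreover have "g / 2 * (sqrt m * h\<^sup>2) = e\<^sup>2 * (g * sqrt m / 2 / h ^ 10)"
      using h by (simp add: e_def field_simps eval_nat_numeral)
    moreover have c5': "g * sqrt m / 2 / h ^ 10 = (c5 / h ^ 5)\<^sup>2"
      using g m by (simp add: c5_def power_divide flip: power_mult)
    ultimately have "e\<^sup>2 * (c5 / h ^ 5)\<^sup>2 \<le> e\<^sup>2 * (norm P)\<^sup>2" unfolding c5' by linarith
    hence "(c5 / h ^ 5)\<^sup>2 \<le> (norm P)\<^sup>2" using e by simp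
    hence P: "c5 / h ^ 5 \<le> norm P" by (rule power2_le_imp_le) auto
    have "norm P \<le> norm (W' (h ^ 4)) + norm (q *\<^sub>R W (h ^ 4))"
      unfolding P_def by (rule norm_triangle_ineq)
    also have "norm (q *\<^sub>R W (h ^ 4)) = q * norm (W (h ^ 4))"
      using slope_bound(1)[OF h(1) hd(1)] unfolding q_def[symmetric] by simp
    also have "q * norm (W (h ^ 4)) \<le> (M / (4 * m) / h ^ 4) * (c / h)"
      using slope_bound[OF h(1) hd(1)] small[OF h4 hd(2)] h m M_pos unfolding q_def
      by (intro mult_mono) auto
    also have "(M / (4 * m) / h ^ 4) * (c / h) = M / (4 * m) * c / h ^ 5"
      using h by (simp add: eval_nat_numeral)
    finally have W'0: "c5 / h ^ 5 \<le> norm (W' (h ^ 4)) + M / (4 * m) * c / h ^ 5" using P by linarith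
    have sub: "{h ^ 4..2 * h ^ 4} \<subseteq> {0..d}" using h4 h by auto
    have cont: "continuous_on {h ^ 4..y} W" "continuous_on {h ^ 4..y} W'" if "y \<le> 2 * h ^ 4" for y
      using sol sub that unfolding semiclassical_solution_def
      by (auto elim!: continuous_on_subset)
    have dW: "(W has_vector_derivative W' x) (at x)"
        "(W' has_vector_derivative (- (a x / e\<^sup>2)) *\<^sub>R W x) (at x)" if "0 < x" "x < d" for x
      using sol that unfolding semiclassical_solution_def e_def by auto
    have W': "norm (W' y - W' (h ^ 4)) \<le> 2 * M * c / h ^ 5" if y: "h ^ 4 \<le> y" "y \<le> 2 * h ^ 4" for y
    proof -
      have "norm (W' y - W' (h ^ 4)) \<le> (2 * M * c / h ^ 9) * (y - h ^ 4)"
      proof (rule norm_diff_le_deriv_bound[OF y(1) cont(2)[OF y(2)]])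
        fix x assume x: "h ^ 4 < x" "x < y"
        have xd: "0 < x" "x < d" using x y h4 h by auto
        show "(W' has_vector_derivative (- (a x / e\<^sup>2)) *\<^sub>R W x) (at x)" using dW xd by simp
        have "norm ((- (a x / e\<^sup>2)) *\<^sub>R W x) = a x * norm (W x) / e\<^sup>2"
          using a_pos[of x] xd by simp
        also have "\<dots> \<le> (M * (2 * h ^ 4)) * (c / h) / e\<^sup>2"
        proof (intro divide_right_mono mult_mono)
          have "a x \<le> M * x" using a_upper xd by simp
          also have "\<dots> \<le> M * (2 * h ^ 4)" using M_pos x y by (intro mult_left_mono) auto
          finally show "a x \<le> M * (2 * h ^ 4)" .
        qed (use small[OF xd] M_pos h in auto)
        also have "\<dots> = 2 * M * c / h ^ 9"
          using h by (simp add: e_def field_simps eval_nat_numeral)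
        finally show "norm ((- (a x / e\<^sup>2)) *\<^sub>R W x) \<le> 2 * M * c / h ^ 9" .
      qed
      also have "\<dots> \<le> (2 * M * c / h ^ 9) * h ^ 4"
        using y M_pos c h by (intro mult_left_mono) auto
      also have "\<dots> = 2 * M * c / h ^ 5" using h by (simp add: field_simps eval_nat_numeral)
      finally show ?thesis .
    qed
    define f where "f = (\<lambda>x. W x - x *\<^sub>R W' (h ^ 4))"
    have "norm (f (2 * h ^ 4) - f (h ^ 4)) \<le> (2 * M * c / h ^ 5) * (2 * h ^ 4 - h ^ 4)"
    proof (rule norm_diff_le_deriv_bound)
      show "continuous_on {h ^ 4..2 * h ^ 4} f"
        unfolding f_def by (intro continuous_intros cont order_refl)
      fix x assume x: "h ^ 4 < x" "x < 2 * h ^ 4"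
      have xd: "0 < x" "x < d" using x h4 h by auto
      show "(f has_vector_derivative W' x - W' (h ^ 4)) (at x)"
        unfolding f_def by (auto intro!: derivative_eq_intros dW xd)
      show "norm (W' x - W' (h ^ 4)) \<le> 2 * M * c / h ^ 5" using W' x by simp
    qed (use h4 in auto)
    also have "\<dots> = 2 * M * c / h" using h by (simp add: field_simps eval_nat_numeral)
    also have "f (2 * h ^ 4) - f (h ^ 4) = W (2 * h ^ 4) - W (h ^ 4) - h ^ 4 *\<^sub>R W' (h ^ 4)"
      by (simp add: f_def algebra_simps flip: scaleR_2)
    finally have T: "norm (W (2 * h ^ 4) - W (h ^ 4) - h ^ 4 *\<^sub>R W' (h ^ 4)) \<le> 2 * M * c / h" .
    have "h ^ 4 * norm (W' (h ^ 4)) = norm (h ^ 4 *\<^sub>R W' (h ^ 4))" using h by simp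
    also have "\<dots> \<le> norm (W (2 * h ^ 4) - W (h ^ 4)) + norm (W (2 * h ^ 4) - W (h ^ 4) - h ^ 4 *\<^sub>R W' (h ^ 4))"
      by (metis norm_minus_commute norm_triangle_sub)
    also have "\<dots> \<le> (c / h + c / h) + 2 * M * c / h"
      using T small[of "2 * h ^ 4"] small[OF h4 hd(2)] h h4
        norm_triangle_ineq4[of "W (2 * h ^ 4)" "W (h ^ 4)"] by linarith
    finally have "h ^ 4 * norm (W' (h ^ 4)) \<le> (2 + 2 * M) * c / h"
      by (simp add: add_divide_distrib algebra_simps)
    moreover have "h ^ 4 * (c5 / h ^ 5) \<le> h ^ 4 * (norm (W' (h ^ 4)) + M / (4 * m) * c / h ^ 5)"
      using W'0 h4 by (intro mult_left_mono) auto
    moreover have "h ^ 4 * (k / h ^ 5) = k / h" for k :: real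
      using h by (simp add: field_simps eval_nat_numeral)
    ultimately have "c5 / h \<le> (2 + 2 * M) * c / h + M / (4 * m) * c / h"
      by (simp only: distrib_left)
    also have "\<dots> = b * c / h" by (simp add: b_def distrib_right add_divide_distrib)
    finally have "c5 \<le> b * c" using h by (simp add: divide_le_cancel)
    thus False using cb by simp
  qed
  thus ?thesis using c by blast
qed

end

section \<open>Essential suprema of continuous functions\<close>

lemma borel_measurable_norm_continuous:
  fixes f :: "real \<Rightarrow> complex"
  assumes "open S" "continuous_on S f"
  shows "(\<lambda>x. ereal (norm (f x))) \<in> borel_measurable (lebesgue_on S)"
proof -
  have "f \<in> borel_measurable (lebesgue_on S)"
    using assms by (intro continuous_imp_measurable_on_sets_lebesgue) auto
  thus ?thesis by measurable
qed

lemma Linf_norm_le: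
  assumes "open S" "continuous_on S f" "\<And>x. x \<in> S \<Longrightarrow> norm (f x) \<le> C"
  shows "Linf_norm S f \<le> ereal C"
  unfolding Linf_norm_def
  by (intro esssup_I borel_measurable_norm_continuous assms AE_I2)
     (use assms in \<open>simp add: space_restrict_space\<close>)

text \<open>
  Points where the norm exceeds the essential supremum form an open null set, which must be empty.
\<close>
lemma norm_le_Linf_norm:
  assumes S: "open S" and cont: "continuous_on S f" and x: "x \<in> S"
  shows "ereal (norm (f x)) \<le> Linf_norm S f"
proof (rule ccontr)
  assume neg: "\<not> ?thesis"
  define A where "A = {y \<in> S. Linf_norm S f < ereal (norm (f y))}"
  have xA: "x \<in> A" using neg x by (simp add: A_def)
  have "continuous_on S (\<lambda>y. ereal (norm (f y)))"
    using cont by (intro continuous_on_ereal continuous_on_norm)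
  hence "open (S \<inter> (\<lambda>y. ereal (norm (f y))) -` {Linf_norm S f<..})"
    using S by (intro continuous_open_preimage) auto
  also have "S \<inter> (\<lambda>y. ereal (norm (f y))) -` {Linf_norm S f<..} = A" by (auto simp: A_def)
  finally have oA: "open A" .
  have SS: "S \<in> sets lebesgue" using S by (simp add: borel_open)
  have "emeasure (lebesgue_on S) A = 0"
    using esssup_zero_measure[of "lebesgue_on S" "\<lambda>y. ereal (norm (f y))"]
    unfolding A_def Linf_norm_def by (simp add: space_restrict_space)
  moreover have "emeasure (lebesgue_on S) A = emeasure lebesgue A"
    using SS by (intro emeasure_restrict_space) (auto simp: A_def)
  ultimately have "A \<in> null_sets lebesgue" using oA by (intro null_setsI) auto
  hence "negligible A" by (simp add: negligible_iff_null_sets)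
  thus False using open_not_negligible[OF oA] xA by auto
qed

section \<open>Gluing at the interface and the energy at the right end\<close>

text \<open>
  The parameters are chosen so that $(z^2/4 + \nu) z'^2 = -(k_1 x^2 + k_2 x)/\varepsilon^2$: completing the
  square in the quadratic potential yields $z$, and the remaining constant is \<open>\<nu>\<close>.
\<close>
lemma z_map_solution:
  fixes k1 k2 \<epsilon> :: real
  assumes "k1 < 0" "\<epsilon> > 0"
  defines "w \<equiv> \<lambda>x. parabolic_cylinder_U (nu_param k1 k2 \<epsilon>) (z_map k1 k2 \<epsilon> x)"
  shows "\<exists>w'. \<forall>x. (w has_real_derivative w' x) (at x) \<and>
      (w' has_real_derivative (- ((k1 * x\<^sup>2 + k2 * x) / \<epsilon>\<^sup>2)) * w x) (at x)"
proof -
  define \<nu> where "\<nu> = nu_param k1 k2 \<epsilon>"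
  obtain U' where U': "weber_solution \<nu> (parabolic_cylinder_U \<nu>) U'"
    using parabolic_cylinder_U_solution by blast
  define K where "K = - (k1 ^ 3)"
  have K: "K > 0" using assms by (simp add: K_def power_less_zero_eq)
  define s where "s = sqrt (2 * \<epsilon>) * K powr (1 / 4)"
  have s: "s > 0" using K assms by (simp add: s_def)
  have "(K powr (1 / 4))\<^sup>2 = sqrt K"
    using K by (simp add: powr_half_sqrt[symmetric] powr_powr flip: powr_realpow)
  hence s2: "s\<^sup>2 = 2 * \<epsilon> * sqrt K" using assms by (simp add: s_def power_mult_distrib)
  have s4: "s\<^sup>2 * s\<^sup>2 = 4 * \<epsilon>\<^sup>2 * K" unfolding s2 using K by (simp add: power2_eq_square)
  define z where "z = (\<lambda>x. (k2 + 2 * k1 * x) / s)"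
  have zeq: "z_map k1 k2 \<epsilon> x = z x" for x by (simp add: z_map_def z_def s_def K_def)
  have nueq: "\<nu> = - (k2\<^sup>2 / (4 * s\<^sup>2))" unfolding \<nu>_def nu_param_def s2 by (simp add: K_def)
  have w: "w = (\<lambda>x. parabolic_cylinder_U \<nu> (z x))"
    unfolding w_def \<nu>_def zeq ..
  have dz: "(z has_real_derivative 2 * k1 / s) (at x)" for x
    unfolding z_def using s by (auto intro!: derivative_eq_intros)
  have U: "(parabolic_cylinder_U \<nu> has_real_derivative U' y) (at y)"
    "(U' has_real_derivative (y\<^sup>2 / 4 + \<nu>) * parabolic_cylinder_U \<nu> y) (at y)" for y
    using U' by (auto simp: weber_solution_def)
  define w' where "w' = (\<lambda>x. U' (z x) * (2 * k1 / s))"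
  have "(w has_real_derivative w' x) (at x)" for x
    unfolding w w'_def by (rule DERIV_chain2[OF U(1) dz])
  moreover have "(w' has_real_derivative (- ((k1 * x\<^sup>2 + k2 * x) / \<epsilon>\<^sup>2)) * w x) (at x)" for x
  proof -
    have "(w' has_real_derivative ((z x)\<^sup>2 / 4 + \<nu>) * parabolic_cylinder_U \<nu> (z x) * (2 * k1 / s) * (2 * k1 / s)) (at x)"
      unfolding w'_def by (intro DERIV_cmult_right DERIV_chain2[OF U(2) dz])
    also have "((z x)\<^sup>2 / 4 + \<nu>) * parabolic_cylinder_U \<nu> (z x) * (2 * k1 / s) * (2 * k1 / s)
        = (((z x)\<^sup>2 / 4 + \<nu>) * (4 * k1\<^sup>2 / s\<^sup>2)) * w x"
      by (simp add: w power2_eq_square)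
    also have "((z x)\<^sup>2 / 4 + \<nu>) * (4 * k1\<^sup>2 / s\<^sup>2) = ((k2 + 2 * k1 * x)\<^sup>2 - k2\<^sup>2) * k1\<^sup>2 / (s\<^sup>2 * s\<^sup>2)"
      using s by (simp add: nueq z_def power_divide field_simps)
    also have "\<dots> = 4 * k1 ^ 3 * (k1 * x\<^sup>2 + k2 * x) / (4 * \<epsilon>\<^sup>2 * K)"
      unfolding s4 by (simp add: power2_eq_square power3_eq_cube algebra_simps)
    also have "\<dots> = - ((k1 * x\<^sup>2 + k2 * x) / \<epsilon>\<^sup>2)"
      using assms by (simp add: K_def field_simps)
    finally show ?thesis .
  qed
  ultimately show ?thesis by blast
qed

text \<open>
  The product is the probability current $\mathrm{Im}(\overline{\psi}\,\psi')$, written as a real inner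
  product.
\<close>
lemma current_conserved:
  fixes \<psi> D :: "real \<Rightarrow> complex"
  assumes sol: "semiclassical_solution e a s t \<psi> D" and "s < t"
  shows "(\<i> * \<psi> t) \<bullet> D t = (\<i> * \<psi> s) \<bullet> D s"
proof (rule DERIV_isconst_end[OF \<open>s < t\<close>])
  show "continuous_on {s..t} (\<lambda>x. (\<i> * \<psi> x) \<bullet> D x)"
    using sol unfolding semiclassical_solution_def by (auto intro!: continuous_intros)
  fix x assume x: "s < x" "x < t"
  hence d: "(\<psi> has_vector_derivative D x) (at x)"
      "(D has_vector_derivative (- (a x / e\<^sup>2)) *\<^sub>R \<psi> x) (at x)"
    using sol unfolding semiclassical_solution_def by auto
  have orth: "(\<i> * u) \<bullet> u = 0" for u :: complex by (simp add: inner_complex_def)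
  show "((\<lambda>x. (\<i> * \<psi> x) \<bullet> D x) has_real_derivative 0) (at x)"
    using has_real_derivative_inner[OF has_vector_derivative_mult_right[OF d(1), of \<i>] d(2)]
    by (simp add: orth)
qed

text \<open>
  For \<open>D1\<close> $= \psi'(1)$, \<open>p1\<close> $= \psi(1)$ and \<open>s\<close> $= \sqrt{a(1)}$: squaring the boundary condition, the mixed
  term is the current at the end point. With vanishing current the condition thus fixes the energy at
  $1$ independently of $e$.
\<close>
lemma energy_at_radiating_end:
  assumes "of_real e * D1 - \<i> * of_real s * p1 = - 2 * \<i> * of_real s" and "(\<i> * p1) \<bullet> D1 = 0"
  shows "e\<^sup>2 * (norm D1)\<^sup>2 + s\<^sup>2 * (norm p1)\<^sup>2 = 4 * s\<^sup>2"
proof -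
  have "(norm (of_real e * D1 - \<i> * of_real s * p1))\<^sup>2
      = e\<^sup>2 * (norm D1)\<^sup>2 + s\<^sup>2 * (norm p1)\<^sup>2 - 2 * e * s * ((\<i> * p1) \<bullet> D1)"
    unfolding cmod_power2 by (simp add: inner_complex_def power2_eq_square algebra_simps)
  thus ?thesis using assms by (simp add: norm_mult power_mult_distrib)
qed

text \<open>
  At \<open>x1\<close> the two one-sided derivatives agree because $\psi$ is differentiable there, so a single
  derivative \<open>D\<close> serves both pieces. On the left piece $\psi$ is a complex constant times a real function,
  hence carries no current; conservation transports this to the right end.
\<close>
lemma glued_solution:
  assumes x1: "0 < x1" "x1 < 1" and k1: "k1 < 0" and "\<epsilon> > 0" and a1: "a 1 \<ge> 0"
    and a: "\<And>x. x \<le> x1 \<Longrightarrow> a x = k1 * x\<^sup>2 + k2 * x"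
    and bvp: "solves_bvp a k1 k2 x1 \<epsilon> \<psi>" and ext: "extended_by_U k1 k2 x1 \<epsilon> \<psi>"
  shows "\<exists>D. semiclassical_solution \<epsilon> a 0 x1 \<psi> D \<and> semiclassical_solution \<epsilon> a x1 1 \<psi> D \<and>
      (\<forall>x\<in>{0<..<1}. (\<psi> has_vector_derivative D x) (at x)) \<and> energy \<epsilon> a \<psi> D 1 = 4 * a 1"
proof -
  define w where "w = (\<lambda>x. parabolic_cylinder_U (nu_param k1 k2 \<epsilon>) (z_map k1 k2 \<epsilon> x))"
  obtain w' where dw: "\<And>x. (w has_real_derivative w' x) (at x)"
    and dw': "\<And>x. (w' has_real_derivative (- ((k1 * x\<^sup>2 + k2 * x) / \<epsilon>\<^sup>2)) * w x) (at x)"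
    using z_map_solution[OF k1 \<open>\<epsilon> > 0\<close>, where ?k2.0 = k2] unfolding w_def by blast
  obtain c where c: "\<And>x. x \<in> {0..x1} \<Longrightarrow> \<psi> x = c * of_real (w x)"
    and diff: "\<psi> differentiable (at x1)"
    using ext unfolding extended_by_U_def w_def by blast
  obtain R where R: "\<And>x. x \<in> {x1..1} \<Longrightarrow> (\<psi> has_vector_derivative R x) (at x within {x1..1})"
    and contR: "continuous_on {x1..1} R"
    and R2: "\<And>x. x \<in> {x1<..<1} \<Longrightarrow> \<exists>\<psi>2. (R has_vector_derivative \<psi>2) (at x) \<and>
           of_real (\<epsilon>\<^sup>2) * \<psi>2 + of_real (a x) * \<psi> x = 0"
    and bc: "of_real \<epsilon> * R 1 - \<i> * of_real (sqrt (a 1)) * \<psi> 1 = - 2 * \<i> * of_real (sqrt (a 1))"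
    using bvp unfolding solves_bvp_def by blast
  define L where "L = (\<lambda>x. c * of_real (w' x))"
  have dcw: "((\<lambda>x. c * of_real (w x)) has_vector_derivative L x) (at x within S)" for x S
    unfolding L_def
    by (intro has_vector_derivative_mult_right has_vector_derivative_of_real
        has_field_derivative_at_within[OF dw])
  have dL: "(L has_vector_derivative (- (a x / \<epsilon>\<^sup>2)) *\<^sub>R \<psi> x) (at x)" if "x \<in> {0..x1}" for x
  proof -
    have "(L has_vector_derivative c * of_real ((- ((k1 * x\<^sup>2 + k2 * x) / \<epsilon>\<^sup>2)) * w x)) (at x)"
      unfolding L_def
      by (intro has_vector_derivative_mult_right has_vector_derivative_of_real
          dw')
    thus ?thesis using that by (simp add: c a scaleR_conv_of_real mult_ac)
  qed
  define v where "v = vector_derivative \<psi> (at x1)"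
  have v: "(\<psi> has_vector_derivative v) (at x1)"
    using diff unfolding v_def vector_derivative_works[symmetric] .
  have vL: "v = L x1"
  proof (rule vector_derivative_unique_within)
    show "at x1 within {0..x1} \<noteq> bot" using x1 by (simp add: trivial_limit_within islimpt_Icc)
    show "(\<psi> has_vector_derivative v) (at x1 within {0..x1})"
      using v by (rule has_vector_derivative_at_within)
    show "(\<psi> has_vector_derivative L x1) (at x1 within {0..x1})"
      by (rule has_vector_derivative_transform[OF _ _ dcw]) (use x1 c in auto)
  qed
  have vR: "v = R x1"
  proof (rule vector_derivative_unique_within)
    show "at x1 within {x1..1} \<noteq> bot" using x1 by (simp add: trivial_limit_within islimpt_Icc)
    show "(\<psi> has_vector_derivative v) (at x1 within {x1..1})"
      using v by (rule has_vector_derivative_at_within)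
    show "(\<psi> has_vector_derivative R x1) (at x1 within {x1..1})"
      using R x1 by auto
  qed
  define D where "D = (\<lambda>x. if x \<le> x1 then L x else R x)"
  have DL: "D x = L x" if "x \<le> x1" for x using that by (simp add: D_def)
  have DR: "D x = R x" if "x \<ge> x1" for x using that vL vR by (auto simp: D_def)
  have d1: "(\<psi> has_vector_derivative D x) (at x)" if "0 < x" "x < x1" for x
  proof (rule has_vector_derivative_transform_within_open[where S = "{0<..<x1}"])
    show "((\<lambda>x. c * of_real (w x)) has_vector_derivative D x) (at x)"
      using dcw that by (simp add: DL)
  qed (use that c in auto)
  have d2: "(\<psi> has_vector_derivative D x) (at x)" if "x1 < x" "x < 1" for x
    using R[of x] that by (simp add: DR at_within_Icc_at)
  have s1: "semiclassical_solution \<epsilon> a 0 x1 \<psi> D"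
    unfolding semiclassical_solution_def
  proof (intro conjI ballI)
    have "continuous_on {0..x1} (\<lambda>x. c * of_real (w x))"
      using dcw by (intro continuous_on_vector_derivative)
    thus "continuous_on {0..x1} \<psi>" by (rule continuous_on_eq) (simp add: c)
    have "continuous_on {0..x1} L"
      by (rule continuous_on_vector_derivative) (rule has_vector_derivative_at_within[OF dL])
    thus "continuous_on {0..x1} D" by (rule continuous_on_eq) (simp add: DL)
    fix x assume x: "x \<in> {0<..<x1}"
    thus "(\<psi> has_vector_derivative D x) (at x)" using d1 by auto
    show "(D has_vector_derivative (- (a x / \<epsilon>\<^sup>2)) *\<^sub>R \<psi> x) (at x)"
    proof (rule has_vector_derivative_transform_within_open[where S = "{0<..<x1}"])
      show "(L has_vector_derivative (- (a x / \<epsilon>\<^sup>2)) *\<^sub>R \<psi> x) (at x)" using dL x by auto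
    qed (use x DL in auto)
  qed
  have s2: "semiclassical_solution \<epsilon> a x1 1 \<psi> D"
    unfolding semiclassical_solution_def
  proof (intro conjI ballI)
    show "continuous_on {x1..1} \<psi>" using R by (rule continuous_on_vector_derivative)
    show "continuous_on {x1..1} D" using contR by (rule continuous_on_eq) (simp add: DR)
    fix x assume x: "x \<in> {x1<..<1}"
    thus "(\<psi> has_vector_derivative D x) (at x)" using d2 by auto
    obtain \<psi>2 where p2: "(R has_vector_derivative \<psi>2) (at x)"
      "of_real (\<epsilon>\<^sup>2) * \<psi>2 + of_real (a x) * \<psi> x = 0" using R2[OF x] by blast
    have "\<psi>2 = (- (a x / \<epsilon>\<^sup>2)) *\<^sub>R \<psi> x"
    proof -
      have "of_real (\<epsilon>\<^sup>2) * \<psi>2 = - (of_real (a x) * \<psi> x)"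
        using p2(2) by (simp add: add_eq_0_iff2)
      hence "of_real (\<epsilon>\<^sup>2) * \<psi>2 = of_real (\<epsilon>\<^sup>2) * ((- (a x / \<epsilon>\<^sup>2)) *\<^sub>R \<psi> x)"
        using \<open>\<epsilon> > 0\<close> by (simp add: scaleR_conv_of_real)
      moreover have "complex_of_real (\<epsilon>\<^sup>2) \<noteq> 0" using \<open>\<epsilon> > 0\<close> by simp
      ultimately show ?thesis by (metis mult_cancel_left)
    qed
    show "(D has_vector_derivative (- (a x / \<epsilon>\<^sup>2)) *\<^sub>R \<psi> x) (at x)"
    proof (rule has_vector_derivative_transform_within_open[where S = "{x1<..<1}"])
      show "(R has_vector_derivative (- (a x / \<epsilon>\<^sup>2)) *\<^sub>R \<psi> x) (at x)"
        using p2(1) \<open>\<psi>2 = _\<close> by simp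
    qed (use x DR in auto)
  qed
  have d: "(\<psi> has_vector_derivative D x) (at x)" if "x \<in> {0<..<1}" for x
    using d1[of x] d2[of x] v vL DL[of x1] that by (cases "x = x1"; cases "x < x1") auto
  have "(\<i> * \<psi> x1) \<bullet> D x1 = 0"
    using x1 by (simp add: DL L_def c inner_complex_def algebra_simps)
  hence "(\<i> * \<psi> 1) \<bullet> D 1 = 0" using current_conserved[OF s2] x1 by simp
  hence "\<epsilon>\<^sup>2 * (norm (D 1))\<^sup>2 + (sqrt (a 1))\<^sup>2 * (norm (\<psi> 1))\<^sup>2 = 4 * (sqrt (a 1))\<^sup>2"
    using bc x1 by (intro energy_at_radiating_end) (simp_all add: DR)
  hence "energy \<epsilon> a \<psi> D 1 = 4 * a 1" using a1 by (simp add: energy_def)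
  thus ?thesis using s1 s2 d by blast
qed

section \<open>The sharp order of the wave function\<close>

lemma C2_on_Icc_deriv_bounded:
  assumes "C2_on f {s..t}"
  shows "\<exists>f' L. L \<ge> 0 \<and>
      (\<forall>x. s < x \<longrightarrow> x < t \<longrightarrow> (f has_real_derivative f' x) (at x) \<and> \<bar>f' x\<bar> \<le> L)"
proof -
  obtain f' f'' where f: "\<And>x. x \<in> {s..t} \<Longrightarrow> (f has_real_derivative f' x) (at x within {s..t})"
      "\<And>x. x \<in> {s..t} \<Longrightarrow> (f' has_real_derivative f'' x) (at x within {s..t})"
    using assms unfolding C2_on_def by blast
  have "continuous_on {s..t} f'" by (rule DERIV_continuous_on[OF f(2)])
  hence "bounded (f' ` {s..t})"
    by (intro compact_imp_bounded compact_continuous_image) auto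
  then obtain L where L: "\<And>x. x \<in> {s..t} \<Longrightarrow> \<bar>f' x\<bar> \<le> L" "L > 0"
    unfolding bounded_pos by (metis imageI real_norm_def)
  have "(f has_real_derivative f' x) (at x) \<and> \<bar>f' x\<bar> \<le> L" if "s < x" "x < t" for x
    using f(1)[of x] L(1)[of x] that by (simp add: at_within_Icc_at)
  thus ?thesis using less_imp_le[OF L(2)] by blast
qed

text \<open>
  The kink of $a$ at \<open>x1\<close> is harmless: the energy is continuous there, so the comparisons on the two
  pieces can be chained.
\<close>
lemma energy_comparable_with_end:
  assumes d: "d \<le> x1" "x1 < 1"
    and cont: "continuous_on {d..1} a" and pos: "\<And>x. x \<in> {d..1} \<Longrightarrow> a x > 0"
    and a': "\<And>x. d < x \<Longrightarrow> x < x1 \<Longrightarrow> (a has_real_derivative a' x) (at x)"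
    and L: "\<And>x. d < x \<Longrightarrow> x < x1 \<Longrightarrow> \<bar>a' x\<bar> \<le> L" "L \<ge> 0"
    and C2: "C2_on a {x1..1}"
  shows "\<exists>K>0. \<exists>\<alpha>>0. (\<forall>x\<in>{d..1}. \<alpha> \<le> a x) \<and>
    (\<forall>e (W :: real \<Rightarrow> 'a::real_inner) D. e \<noteq> 0 \<longrightarrow> semiclassical_solution e a d x1 W D \<longrightarrow>
        semiclassical_solution e a x1 1 W D \<longrightarrow>
        (\<forall>y\<in>{d..1}. energy e a W D y \<le> K * energy e a W D 1 \<and>
                     energy e a W D 1 \<le> K * energy e a W D y))"
proof -
  obtain x0 where x0: "x0 \<in> {d..1}" "\<And>x. x \<in> {d..1} \<Longrightarrow> a x0 \<le> a x"
    using continuous_attains_inf[of "{d..1}" a] cont d by auto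
  define \<alpha> where "\<alpha> = a x0"
  have \<alpha>: "\<alpha> > 0" "\<And>x. x \<in> {d..1} \<Longrightarrow> \<alpha> \<le> a x"
    using x0 pos by (auto simp: \<alpha>_def)
  obtain f' M where f': "M \<ge> 0" "\<And>x. x1 < x \<Longrightarrow> x < 1 \<Longrightarrow> (a has_real_derivative f' x) (at x)"
      "\<And>x. x1 < x \<Longrightarrow> x < 1 \<Longrightarrow> \<bar>f' x\<bar> \<le> M"
    using C2_on_Icc_deriv_bounded[OF C2] by blast
  define K1 where "K1 = exp (L / \<alpha> * (x1 - d))"
  define K2 where "K2 = exp (M / \<alpha> * (1 - x1))"
  have K: "K1 \<ge> 1" "K2 \<ge> 1"
    using L(2) f'(1) \<alpha>(1) d unfolding K1_def K2_def
    by (auto intro!: mult_nonneg_nonneg divide_nonneg_nonneg)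
  have "energy e a W D y \<le> K1 * K2 * energy e a W D 1 \<and> energy e a W D 1 \<le> K1 * K2 * energy e a W D y"
    if e: "e \<noteq> 0" and s1: "semiclassical_solution e a d x1 W D" and s2: "semiclassical_solution e a x1 1 W D"
      and y: "y \<in> {d..1}" for e y and W D :: "real \<Rightarrow> 'a"
  proof -
    define E where "E = energy e a W D"
    have E0: "E x \<ge> 0" if "x \<in> {d..1}" for x
      using pos[OF that] by (simp add: E_def energy_def)
    have 1: "E y \<le> K1 * E x" if "x \<in> {d..x1}" "y \<in> {d..x1}" for x y
      unfolding E_def K1_def
    proof (rule energy_comparable[OF s1 e _ a' L \<alpha>(1) _ that])
      show "continuous_on {d..x1} a" using cont by (rule continuous_on_subset) (use d in auto)
    qed (use \<alpha> d in auto)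
    have 2: "E y \<le> K2 * E x" if "x \<in> {x1..1}" "y \<in> {x1..1}" for x y
      unfolding E_def K2_def
    proof (rule energy_comparable[OF s2 e _ f'(2,3,1) \<alpha>(1) _ that])
      show "continuous_on {x1..1} a" using cont by (rule continuous_on_subset) (use d in auto)
    qed (use \<alpha> d in auto)
    show ?thesis
    proof (cases "y \<le> x1")
      case True
      have "E y \<le> K1 * E x1" "E x1 \<le> K1 * E y" using 1 True y d by auto
      moreover have "E x1 \<le> K2 * E 1" "E 1 \<le> K2 * E x1" using 2 d by auto
      moreover have "K1 * E x1 \<le> K1 * (K2 * E 1)" "K2 * E x1 \<le> K2 * (K1 * E y)"
        using calculation K by (auto intro!: mult_left_mono)
      ultimately show ?thesis unfolding E_def[symmetric] by (auto simp: mult_ac)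
    next
      case False
      have "E y \<le> K2 * E 1" "E 1 \<le> K2 * E y" using 2 False y d by auto
      moreover have "K2 * E 1 \<le> K1 * (K2 * E 1)" "K2 * E y \<le> K1 * (K2 * E y)"
        using K E0[of 1] E0[OF y] d mult_right_mono[of 1 K1 "K2 * E 1"] mult_right_mono[of 1 K1 "K2 * E y"]
        by auto
      ultimately show ?thesis unfolding E_def[symmetric] by (auto simp: mult_ac)
    qed
  qed
  moreover have "K1 * K2 > 0" by (simp add: K1_def K2_def)
  ultimately show ?thesis using \<alpha> by blast
qed

theorem proposition6p5:
  fixes x1 E k1 k2 :: real
    and V a :: "real \<Rightarrow> real"
    and \<psi> :: "real \<Rightarrow> real \<Rightarrow> complex"
  assumes "0 < x1" and "x1 < 1"
    and "continuous_on UNIV V"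
    and "a = (\<lambda>x. E - V x)"
    and "\<And>x. 0 < x \<Longrightarrow> x \<le> 1 \<Longrightarrow> V x < V 0"
    and "\<And>x. x \<le> x1 \<Longrightarrow> a x = k1 * x^2 + k2 * x"
    and "k1 < 0" and "k2 > - k1 * x1" and "- k1 * x1 > 0"
    and "\<And>x. x > 1 \<Longrightarrow> V x = V 1"
    and "C2_on a {x1..1}"
    and "\<And>\<epsilon>. \<epsilon> > 0 \<Longrightarrow> solves_bvp a k1 k2 x1 \<epsilon> (\<psi> \<epsilon>)"
    and "\<And>\<epsilon>. \<epsilon> > 0 \<Longrightarrow> extended_by_U k1 k2 x1 \<epsilon> (\<psi> \<epsilon>)"
  shows "Theta_at_0 (\<lambda>\<epsilon>. Linf_norm {0<..<1} (\<psi> \<epsilon>)) (\<lambda>\<epsilon>. \<epsilon> powr (- 1 / 6)) \<and>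
         (\<exists>C::real. \<exists>\<delta>>0. \<forall>\<epsilon>. 0 < \<epsilon> \<and> \<epsilon> < \<delta> \<longrightarrow>
            ereal \<epsilon> * Linf_norm {0<..<1} (\<lambda>x. vector_derivative (\<psi> \<epsilon>) (at x)) \<le> ereal C)"
proof -
  note x1 = \<open>0 < x1\<close> \<open>x1 < 1\<close> and k1 = \<open>k1 < 0\<close> and a_left = assms(6)
  have cont_a: "continuous_on S a" for S
    using assms(3) unfolding assms(4) by (intro continuous_intros) (auto intro: continuous_on_subset)
  have "a 0 = 0" using a_left[of 0] x1 by simp
  hence a_pos: "a x > 0" if "0 < x" "x \<le> 1" for x
    using assms(5)[OF that] by (simp add: assms(4))
  \<comment> \<open>Up to half of \<open>x1\<close> the derivative of $a$ stays positive: $k_2 + 2 k_1 x \ge k_2 + k_1 x_1 > 0$.\<close>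
  define d where "d = x1 / 2"
  have d: "0 < d" "d < x1" "d < 1" using x1 by (auto simp: d_def)
  define a' where "a' = (\<lambda>x. k2 + 2 * k1 * x)"
  have deriv_a: "(a has_real_derivative a' x) (at x)" if "x < x1" for x
  proof (rule has_field_derivative_transform_within_open[where S = "{..<x1}"])
    show "((\<lambda>x. k1 * x\<^sup>2 + k2 * x) has_real_derivative a' x) (at x)"
      by (auto intro!: derivative_eq_intros simp: a'_def)
  qed (use that a_left in auto)
  define m where "m = k2 + k1 * x1"
  have m: "m > 0" using assms(8) by (simp add: m_def)
  have k2: "k2 > 0" using assms(8,9) by linarith
  have k1_le: "k1 * x1 \<le> k1 * y" if "y \<le> x1" for y using that k1 by simp
  interpret tp: simple_turning_point a a' "\<lambda>_. 2 * k1" d m k2 "2 * \<bar>k1\<bar>"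
  proof
    fix x assume x: "0 \<le> x" "x \<le> d"
    hence x': "x < x1" using d by simp
    show "(a has_real_derivative a' x) (at x)" by (rule deriv_a[OF x'])
    show "(a' has_real_derivative 2 * k1) (at x)"
      unfolding a'_def by (auto intro!: derivative_eq_intros)
    have eq: "a x = (k2 + k1 * x) * x" using a_left[of x] x' by (simp add: power2_eq_square algebra_simps)
    show "m * x \<le> a x" unfolding eq m_def using x x' k1_le[of x] by (intro mult_right_mono) auto
    show "a x \<le> k2 * x" unfolding eq using x k1 by (intro mult_right_mono) (auto intro: mult_nonpos_nonneg)
    show "0 \<le> a' x" using k1_le[of "2 * x"] m x by (simp add: a'_def m_def d_def)
    show "a' x \<le> k2" using k1 x by (simp add: a'_def mult_nonpos_nonneg)
  qed (use d m in auto)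
  have L: "\<bar>a' x\<bar> \<le> k2 + 2 * \<bar>k1\<bar>" if "d < x" "x < x1" for x
  proof -
    have "\<bar>k1 * x\<bar> \<le> \<bar>k1\<bar>" using that d x1 by (simp add: abs_mult mult_left_le)
    thus ?thesis unfolding a'_def using k2 by linarith
  qed
  have "\<exists>K>0. \<exists>\<alpha>>0. (\<forall>x\<in>{d..1}. \<alpha> \<le> a x) \<and>
    (\<forall>e (W :: real \<Rightarrow> complex) D. e \<noteq> 0 \<longrightarrow> semiclassical_solution e a d x1 W D \<longrightarrow>
        semiclassical_solution e a x1 1 W D \<longrightarrow>
        (\<forall>y\<in>{d..1}. energy e a W D y \<le> K * energy e a W D 1 \<and>
                     energy e a W D 1 \<le> K * energy e a W D y))"
    using d x1 k2 by (intro energy_comparable_with_end[OF _ _ cont_a _ deriv_a L _ assms(11)] a_pos) auto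
  then obtain K \<alpha> where K: "K > 0" and \<alpha>: "\<alpha> > 0" "\<And>x. x \<in> {d..1} \<Longrightarrow> \<alpha> \<le> a x"
    and KE: "\<And>e (W :: real \<Rightarrow> complex) D y. e \<noteq> 0 \<Longrightarrow> semiclassical_solution e a d x1 W D \<Longrightarrow>
        semiclassical_solution e a x1 1 W D \<Longrightarrow> y \<in> {d..1} \<Longrightarrow>
        energy e a W D y \<le> K * energy e a W D 1 \<and> energy e a W D 1 \<le> K * energy e a W D y"
    by blast
  have a1: "a 1 > 0" using a_pos[of 1] by simp
  \<comment> \<open>The energy on $[d, 1]$ lies between \<open>n\<close> and \<open>N\<close> for every \<open>\<epsilon>\<close>, since it equals $4 a(1)$ at $1$.\<close>
  define N where "N = K * (4 * a 1)"
  define n where "n = 4 * a 1 / K"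
  have N: "N > 0" "n > 0" using K a1 by (auto simp: N_def n_def)
  obtain C where C: "C > 0" "\<And>h (W :: real \<Rightarrow> complex) W' x. 0 < h \<Longrightarrow> h \<le> 1 \<Longrightarrow> h ^ 4 \<le> d \<Longrightarrow>
           semiclassical_solution (h ^ 6) a 0 d W W' \<Longrightarrow> energy (h ^ 6) a W W' d \<le> N \<Longrightarrow>
           x \<in> {0..d} \<Longrightarrow> norm (W x) \<le> C / h"
    using tp.turning_point_upper[of N, where 'a = complex] N by (metis less_imp_le)
  obtain c where c: "c > 0" "\<And>h (W :: real \<Rightarrow> complex) W'. 0 < h \<Longrightarrow> h \<le> 1 \<Longrightarrow> 2 * h ^ 4 < d \<Longrightarrow>
           semiclassical_solution (h ^ 6) a 0 d W W' \<Longrightarrow> n \<le> energy (h ^ 6) a W W' d \<Longrightarrow>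
           \<exists>x\<in>{0<..<d}. c / h \<le> norm (W x)"
    using tp.turning_point_lower[of n, where 'a = complex] N by metis
  define C' where "C' = max C (sqrt (N / \<alpha>))"
  \<comment> \<open>This makes $h = \varepsilon^{1/6}$ less than $1$ and $d/2$, so that $2h^4 < d$: twice the layer fits into
    $[0, d]$.\<close>
  define \<delta> where "\<delta> = min 1 ((d / 2) ^ 6)"
  have \<delta>: "\<delta> > 0" using d by (simp add: \<delta>_def)
  have main: "ereal (c * (\<epsilon> powr (- 1 / 6))) \<le> Linf_norm {0<..<1} (\<psi> \<epsilon>) \<and>
      Linf_norm {0<..<1} (\<psi> \<epsilon>) \<le> ereal (C' * (\<epsilon> powr (- 1 / 6))) \<and>
      ereal \<epsilon> * Linf_norm {0<..<1} (\<lambda>x. vector_derivative (\<psi> \<epsilon>) (at x)) \<le> ereal (sqrt N)"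
    if \<epsilon>: "0 < \<epsilon>" "\<epsilon> < \<delta>" for \<epsilon>
  proof -
    define h where "h = \<epsilon> powr (1 / 6)"
    have h0: "h > 0" using \<epsilon> by (simp add: h_def)
    have h6: "h ^ 6 = \<epsilon>" using \<epsilon> by (simp add: h_def powr_powr flip: powr_realpow)
    have hinv: "\<epsilon> powr (- 1 / 6) = 1 / h" using \<epsilon> by (simp add: h_def powr_minus_divide)
    have "h ^ 6 < 1 ^ 6" "h ^ 6 < (d / 2) ^ 6" using \<epsilon> by (auto simp: h6 \<delta>_def)
    hence h: "h < 1" "h < d / 2"
      using power_less_imp_less_base[of h 6 1] power_less_imp_less_base[of h 6 "d / 2"] d by auto
    have "h ^ 4 \<le> h ^ 1" using h h0 by (intro power_decreasing) auto
    hence h4: "2 * h ^ 4 < d" "h ^ 4 \<le> d" using h d by auto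
    obtain D where s1: "semiclassical_solution \<epsilon> a 0 x1 (\<psi> \<epsilon>) D"
      and s2: "semiclassical_solution \<epsilon> a x1 1 (\<psi> \<epsilon>) D"
      and D: "\<And>x. x \<in> {0<..<1} \<Longrightarrow> (\<psi> \<epsilon> has_vector_derivative D x) (at x)"
      and E1: "energy \<epsilon> a (\<psi> \<epsilon>) D 1 = 4 * a 1"
      using glued_solution[OF x1 k1 \<epsilon>(1) less_imp_le[OF a1] a_left assms(12,13)[OF \<epsilon>(1)]] by blast
    have s0: "semiclassical_solution (h ^ 6) a 0 d (\<psi> \<epsilon>) D"
      unfolding h6 using semiclassical_solution_subset[OF s1] d by auto
    have sd: "semiclassical_solution \<epsilon> a d x1 (\<psi> \<epsilon>) D"
      using semiclassical_solution_subset[OF s1] d by auto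
    have Ey: "energy \<epsilon> a (\<psi> \<epsilon>) D y \<le> N" "n \<le> energy \<epsilon> a (\<psi> \<epsilon>) D y" if "y \<in> {d..1}" for y
      using KE[OF _ sd s2 that] \<epsilon> K by (auto simp: E1 N_def n_def field_simps)
    have cont: "continuous_on {0<..<1} (\<psi> \<epsilon>)"
      by (rule continuous_on_vector_derivative) (rule has_vector_derivative_at_within[OF D])
    have "continuous_on ({0..x1} \<union> {x1..1}) D"
      using s1 s2 unfolding semiclassical_solution_def by (intro continuous_on_closed_Un) auto
    hence "continuous_on {0<..<1} D" by (rule continuous_on_subset) auto
    hence contD: "continuous_on {0<..<1} (\<lambda>x. vector_derivative (\<psi> \<epsilon>) (at x))"
      by (rule continuous_on_eq) (simp add: vector_derivative_at[OF D])
    obtain x where x: "x \<in> {0<..<d}" "c / h \<le> norm (\<psi> \<epsilon> x)"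
      using c(2)[OF h0 _ h4(1) s0] Ey(2)[of d] h d by (auto simp: h6)
    have "ereal (c / h) \<le> ereal (norm (\<psi> \<epsilon> x))" using x by simp
    also have "\<dots> \<le> Linf_norm {0<..<1} (\<psi> \<epsilon>)"
      using x d by (intro norm_le_Linf_norm cont) auto
    finally have lower: "ereal (c / h) \<le> Linf_norm {0<..<1} (\<psi> \<epsilon>)" .
    have "norm (\<psi> \<epsilon> x) \<le> C' / h" if x: "x \<in> {0<..<1}" for x
    proof (cases "x \<le> d")
      case True
      hence "norm (\<psi> \<epsilon> x) \<le> C / h"
        using C(2)[OF h0 _ h4(2) s0] Ey(1)[of d] h d x by (auto simp: h6)
      also have "\<dots> \<le> C' / h" using h0 by (intro divide_right_mono) (auto simp: C'_def)
      finally show ?thesis .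
    next
      case False
      have "\<alpha> * (norm (\<psi> \<epsilon> x))\<^sup>2 \<le> a x * (norm (\<psi> \<epsilon> x))\<^sup>2"
        using \<alpha>(2)[of x] False x by (intro mult_right_mono) auto
      also have "\<dots> \<le> energy \<epsilon> a (\<psi> \<epsilon>) D x" by (simp add: energy_def)
      also have "\<dots> \<le> N" using Ey(1)[of x] False x by auto
      finally have "(norm (\<psi> \<epsilon> x))\<^sup>2 \<le> N / \<alpha>" using \<alpha> by (simp add: field_simps)
      hence "norm (\<psi> \<epsilon> x) \<le> sqrt (N / \<alpha>)" by (rule real_le_rsqrt)
      also have "\<dots> \<le> C'" by (simp add: C'_def)
      also have "\<dots> \<le> C' / h"
      proof -
        have "C' * h \<le> C' * 1" using h C(1) by (intro mult_left_mono) (auto simp: C'_def)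
        thus ?thesis using h0 by (simp add: pos_le_divide_eq)
      qed
      finally show ?thesis .
    qed
    hence upper: "Linf_norm {0<..<1} (\<psi> \<epsilon>) \<le> ereal (C' / h)"
      by (intro Linf_norm_le cont) auto
    have "norm (vector_derivative (\<psi> \<epsilon>) (at x)) \<le> sqrt N / \<epsilon>" if x: "x \<in> {0<..<1}" for x
    proof -
      have "\<epsilon>\<^sup>2 * (norm (D x))\<^sup>2 \<le> energy \<epsilon> a (\<psi> \<epsilon>) D x"
        unfolding energy_def using a_pos[of x] x by simp
      also have "\<dots> \<le> N"
      proof (cases "x \<le> d")
        case True
        have "energy \<epsilon> a (\<psi> \<epsilon>) D x \<le> energy \<epsilon> a (\<psi> \<epsilon>) D d"
        proof (rule energy_mono[where a' = a'])
          show "semiclassical_solution \<epsilon> a x d (\<psi> \<epsilon>) D"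
            using semiclassical_solution_subset[OF s1] x d by auto
        qed (use True x d \<epsilon> in \<open>auto intro!: cont_a deriv_a tp.a'_nonneg\<close>)
        also have "\<dots> \<le> N" using Ey(1)[of d] d by simp
        finally show ?thesis .
      qed (use Ey(1)[of x] x in auto)
      finally have "(\<epsilon> * norm (D x))\<^sup>2 \<le> N" by (simp add: power_mult_distrib)
      hence "\<epsilon> * norm (D x) \<le> sqrt N" by (rule real_le_rsqrt)
      thus ?thesis using \<epsilon> by (simp add: vector_derivative_at[OF D[OF x]] field_simps)
    qed
    hence "Linf_norm {0<..<1} (\<lambda>x. vector_derivative (\<psi> \<epsilon>) (at x)) \<le> ereal (sqrt N / \<epsilon>)"
      by (intro Linf_norm_le contD) auto
    hence "ereal \<epsilon> * Linf_norm {0<..<1} (\<lambda>x. vector_derivative (\<psi> \<epsilon>) (at x))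
        \<le> ereal \<epsilon> * ereal (sqrt N / \<epsilon>)"
      using \<epsilon> by (intro ereal_mult_left_mono) auto
    also have "\<dots> = ereal (sqrt N)" using \<epsilon> by simp
    finally show ?thesis using lower upper unfolding hinv by simp
  qed
  have "Theta_at_0 (\<lambda>\<epsilon>. Linf_norm {0<..<1} (\<psi> \<epsilon>)) (\<lambda>\<epsilon>. \<epsilon> powr (- 1 / 6))"
    unfolding Theta_at_0_def
  proof (intro exI conjI allI impI)
    fix \<epsilon> :: real assume \<epsilon>: "0 < \<epsilon> \<and> \<epsilon> < \<delta>"
    note b = main[of \<epsilon>, OF conjunct1[OF \<epsilon>] conjunct2[OF \<epsilon>]]
    have "(0::ereal) \<le> ereal (c * \<epsilon> powr (- 1 / 6))" using c(1) by simp
    hence "0 \<le> Linf_norm {0<..<1} (\<psi> \<epsilon>)" using b by (meson order_trans)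
    thus "ereal (c * \<bar>\<epsilon> powr (- 1 / 6)\<bar>) \<le> \<bar>Linf_norm {0<..<1} (\<psi> \<epsilon>)\<bar>"
      "\<bar>Linf_norm {0<..<1} (\<psi> \<epsilon>)\<bar> \<le> ereal (C' * \<bar>\<epsilon> powr (- 1 / 6)\<bar>)"
      using b by simp_all
  qed (use c(1) C(1) \<delta> in \<open>auto simp: C'_def\<close>)
  thus ?thesis using main \<delta> by blast
qed

end
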